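(* Let $n\ge 2$, let $\mathcal T$ be an operator system and let $\phi:C(S^1)_{(n)}\to\mathcal T$ be a linear map. Then $\phi$ is completely positive if and only if $\phi^{(n)}(T_n)$ is positive in $\mathcal M_n(\mathcal T)$, where $\phi^{(n)}:\mathcal M_n(C(S^1)_{(n)})\to\mathcal M_n(\mathcal T)$ is the ampliation of $\phi$ (entrywise application of $\phi$).
   Context: $C(S^1)_{(n)}$ is the operator subsystem of $C(S^1)$ consisting of all $f(z)=\sum_{\ell=-n+1}^{n-1}\alpha_\ell z^\ell$, $\alpha_\ell\in\mathbb C$; a matrix $F\in\mathcal M_p(C(S^1)_{(n)})$ is positive iff $F(z)$ is positive semidefinite for every $z\in S^1$. $T_n\in\mathcal M_n(C(S^1)_{(n)})$ is the matrix $[\chi_{k-\ell}]_{k,\ell=0}^{n-1}$, where $\chi_j(z)=z^j$. *)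

theory Defs
  imports
    "HOL-Analysis.Analysis"
    "HOL-Library.Function_Algebras"
    "Jordan_Normal_Form.Matrix"
begin

no_notation Finite_Cartesian_Product.vec_nth (infixl \<open>$\<close> 90)

section \<open>Abstract operator systems\<close>

text \<open>
  The underlying *-vector space is a subspace \<open>os_space S\<close> of a complex vector space whose
  addition is that of the type \<open>'v\<close>; \<open>os_cone S p\<close> is the set of positive elements of the
  \<open>p \<times> p\<close> matrices over it.
\<close>

record 'v os =
  os_space :: "'v set"
  os_scale :: "complex \<Rightarrow> 'v \<Rightarrow> 'v"
  os_star :: "'v \<Rightarrow> 'v"
  os_cone :: "nat \<Rightarrow> 'v mat set"
  os_unit :: "'v"

definition os_mats :: "'v os \<Rightarrow> nat \<Rightarrow> 'v mat set" where
  "os_mats S p = {A \<in> carrier_mat p p. \<forall>i<p. \<forall>j<p. A $$ (i, j) \<in> os_space S}"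

definition os_herm :: "'v os \<Rightarrow> nat \<Rightarrow> 'v mat set" where
  "os_herm S p = {A \<in> os_mats S p. \<forall>i<p. \<forall>j<p. A $$ (i, j) = os_star S (A $$ (j, i))}"

text \<open>The multiple \<open>r \<cdot> (e \<oplus> \<dots> \<oplus> e)\<close> of the order unit of the \<open>p \<times> p\<close> matrices.\<close>

definition os_unit_mat :: "'v::zero os \<Rightarrow> nat \<Rightarrow> real \<Rightarrow> 'v mat" where
  "os_unit_mat S p r =
     mat p p (\<lambda>(i, j). if i = j then os_scale S (complex_of_real r) (os_unit S) else 0)"

text \<open>The product \<open>X\<^sup>* A X\<close> for a scalar matrix \<open>X\<close>.\<close>

definition os_compress :: "'v::comm_monoid_add os \<Rightarrow> complex mat \<Rightarrow> 'v mat \<Rightarrow> 'v mat" where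
  "os_compress S X A = mat (dim_col X) (dim_col X) (\<lambda>(i, j).
     \<Sum>k<dim_row X. \<Sum>l<dim_row X. os_scale S (cnj (X $$ (k, i)) * X $$ (l, j)) (A $$ (k, l)))"

text \<open>
  Operator systems in the sense of Choi and Effros: matrix-ordered *-vector spaces with an
  Archimedean matrix order unit. The size \<open>p = 0\<close> is not excluded; there the axioms merely force
  \<open>os_cone S 0\<close> to consist of the empty matrix.
\<close>

locale operator_system = vector_space "os_scale S" for S :: "'v::ab_group_add os" +
  assumes space: "subspace (os_space S)"
    and star_closed: "x \<in> os_space S \<Longrightarrow> os_star S x \<in> os_space S"
    and star_star: "x \<in> os_space S \<Longrightarrow> os_star S (os_star S x) = x"
    and star_add: "x \<in> os_space S \<Longrightarrow> y \<in> os_space S \<Longrightarrow>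
      os_star S (x + y) = os_star S x + os_star S y"
    and star_scale: "x \<in> os_space S \<Longrightarrow>
      os_star S (os_scale S c x) = os_scale S (cnj c) (os_star S x)"
    and cone_herm: "os_cone S p \<subseteq> os_herm S p"
    and cone_add: "A \<in> os_cone S p \<Longrightarrow> B \<in> os_cone S p \<Longrightarrow> A + B \<in> os_cone S p"
    and cone_scale: "A \<in> os_cone S p \<Longrightarrow> 0 \<le> r \<Longrightarrow>
      map_mat (os_scale S (complex_of_real r)) A \<in> os_cone S p"
    and cone_proper: "A \<in> os_cone S p \<Longrightarrow> - A \<in> os_cone S p \<Longrightarrow> A = 0\<^sub>m p p"
    and cone_compress: "A \<in> os_cone S p \<Longrightarrow> X \<in> carrier_mat p q \<Longrightarrow>
      os_compress S X A \<in> os_cone S q"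
    and unit_space: "os_unit S \<in> os_space S"
    and unit_star: "os_star S (os_unit S) = os_unit S"
    and order_unit: "A \<in> os_herm S p \<Longrightarrow> \<exists>r>0. os_unit_mat S p r - A \<in> os_cone S p"
    and archimedean: "A \<in> os_mats S p \<Longrightarrow>
      (\<And>r. r > 0 \<Longrightarrow> os_unit_mat S p r + A \<in> os_cone S p) \<Longrightarrow> A \<in> os_cone S p"

definition os_linear ::
  "'v::ab_group_add os \<Rightarrow> 'w::ab_group_add os \<Rightarrow> ('v \<Rightarrow> 'w) \<Rightarrow> bool" where
  "os_linear S T \<phi> \<longleftrightarrow>
     (\<forall>x\<in>os_space S. \<phi> x \<in> os_space T) \<and>
     (\<forall>x\<in>os_space S. \<forall>y\<in>os_space S. \<phi> (x + y) = \<phi> x + \<phi> y) \<and>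
     (\<forall>c. \<forall>x\<in>os_space S. \<phi> (os_scale S c x) = os_scale T c (\<phi> x))"

text \<open>The ampliation of \<open>\<phi>\<close> to matrices of any size is \<open>map_mat \<phi>\<close>.\<close>

definition completely_positive :: "'v os \<Rightarrow> 'w os \<Rightarrow> ('v \<Rightarrow> 'w) \<Rightarrow> bool" where
  "completely_positive S T \<phi> \<longleftrightarrow> (\<forall>p. \<forall>A\<in>os_cone S p. map_mat \<phi> A \<in> os_cone T p)"

definition os_sub :: "'v os \<Rightarrow> 'v set \<Rightarrow> 'v os" where
  "os_sub S V = S\<lparr>os_space := V,
     os_cone := \<lambda>p. {A \<in> os_cone S p. \<forall>i<p. \<forall>j<p. A $$ (i, j) \<in> V}\<rparr>"

section \<open>Continuous functions and trigonometric polynomials on the circle\<close>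

abbreviation circle :: "complex set" where
  "circle \<equiv> sphere 0 1"

text \<open>For complex scalars the condition below includes that the quadratic form is real-valued.\<close>

definition psd :: "complex mat \<Rightarrow> bool" where
  "psd A \<longleftrightarrow> square_mat A \<and> (\<forall>v\<in>carrier_vec (dim_row A). 0 \<le> (A *\<^sub>v v) \<bullet>c v)"

text \<open>
  Functions on the circle are represented by functions on the plane that vanish off the circle, so
  that equality of representatives is equality on the circle.
\<close>

definition circle_cont :: "(complex \<Rightarrow> complex) set" where
  "circle_cont = {f. continuous_on circle f \<and> (\<forall>z. z \<notin> circle \<longrightarrow> f z = 0)}"

definition C_circle :: "(complex \<Rightarrow> complex) os" where
  "C_circle = \<lparr>
     os_space = circle_cont,
     os_scale = (\<lambda>c f z. c * f z),
     os_star = (\<lambda>f z. cnj (f z)),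
     os_cone = (\<lambda>p. {F \<in> carrier_mat p p.
       (\<forall>i<p. \<forall>j<p. F $$ (i, j) \<in> circle_cont) \<and>
       (\<forall>z\<in>circle. psd (map_mat (\<lambda>f. f z) F))}),
     os_unit = (\<lambda>z. if z \<in> circle then 1 else 0)\<rparr>"

definition circle_char :: "int \<Rightarrow> complex \<Rightarrow> complex" where
  "circle_char j z = (if z \<in> circle then z powi j else 0)"

definition trig_poly :: "nat \<Rightarrow> (complex \<Rightarrow> complex) set" where
  "trig_poly n = {f. \<exists>\<alpha>. f = (\<lambda>z. \<Sum>l\<in>{- int n + 1..int n - 1}. \<alpha> l * circle_char l z)}"

definition C_circle_n :: "nat \<Rightarrow> (complex \<Rightarrow> complex) os" where
  "C_circle_n n = os_sub C_circle (trig_poly n)"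

definition toeplitz_mat :: "nat \<Rightarrow> (complex \<Rightarrow> complex) mat" where
  "toeplitz_mat n = mat n n (\<lambda>(k, l). circle_char (int k - int l))"

section \<open>These are operator systems\<close>

definition qform :: "nat \<Rightarrow> (nat \<Rightarrow> nat \<Rightarrow> complex) \<Rightarrow> (nat \<Rightarrow> complex) \<Rightarrow> complex" where
  "qform p a v = (\<Sum>i<p. \<Sum>j<p. a i j * v j * cnj (v i))"

lemma qform_mat:
  assumes "A \<in> carrier_mat p p" "v \<in> carrier_vec p"
  shows "(A *\<^sub>v v) \<bullet>c v = qform p (\<lambda>i j. A $$ (i, j)) (\<lambda>i. v $ i)"
  using assms
  by (auto simp: qform_def scalar_prod_def sum_distrib_right lessThan_atLeast0 intro!: sum.cong)

lemma qform_cong: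
  "(\<And>i j. i < p \<Longrightarrow> j < p \<Longrightarrow> a i j = b i j) \<Longrightarrow> (\<And>i. i < p \<Longrightarrow> v i = w i) \<Longrightarrow>
    qform p a v = qform p b w"
  by (simp add: qform_def)

lemma psd_iff:
  assumes "A \<in> carrier_mat p p"
  shows "psd A \<longleftrightarrow> (\<forall>v. 0 \<le> qform p (\<lambda>i j. A $$ (i, j)) v)"
proof
  assume *: "psd A"
  show "\<forall>v. 0 \<le> qform p (\<lambda>i j. A $$ (i, j)) v"
  proof
    fix v :: "nat \<Rightarrow> complex"
    have "0 \<le> (A *\<^sub>v vec p v) \<bullet>c vec p v"
      using * assms by (auto simp: psd_def)
    also have "\<dots> = qform p (\<lambda>i j. A $$ (i, j)) (\<lambda>i. vec p v $ i)"
      by (rule qform_mat[OF assms]) simp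
    also have "\<dots> = qform p (\<lambda>i j. A $$ (i, j)) v"
      by (rule qform_cong) auto
    finally show "0 \<le> qform p (\<lambda>i j. A $$ (i, j)) v" .
  qed
next
  assume "\<forall>v. 0 \<le> qform p (\<lambda>i j. A $$ (i, j)) v"
  then show "psd A"
    using assms by (auto simp: psd_def qform_mat[OF assms])
qed

lemma qform_two:
  assumes "i < p" "j < p" "i \<noteq> j"
  shows "qform p a ((\<lambda>_. 0)(i := 1, j := c)) =
    a i i + a j j * c * cnj c + a i j * c + a j i * cnj c"
proof -
  let ?v = "(\<lambda>_. 0)(i := 1, j := c) :: nat \<Rightarrow> complex"
  have inner: "(\<Sum>l<p. a k l * ?v l * cnj (?v k)) = (a k i + a k j * c) * cnj (?v k)" for k
  proof -
    have "(\<Sum>l<p. a k l * ?v l * cnj (?v k)) = (\<Sum>l\<in>{i, j}. a k l * ?v l * cnj (?v k))"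
      using assms by (intro sum.mono_neutral_right) auto
    then show ?thesis using assms by (simp add: algebra_simps)
  qed
  have "qform p a ?v = (\<Sum>k<p. (a k i + a k j * c) * cnj (?v k))"
    unfolding qform_def inner ..
  also have "\<dots> = (\<Sum>k\<in>{i, j}. (a k i + a k j * c) * cnj (?v k))"
    using assms by (intro sum.mono_neutral_right) auto
  finally show ?thesis using assms by (simp add: algebra_simps)
qed

lemma qform_one:
  assumes "i < p"
  shows "qform p a ((\<lambda>_. 0)(i := 1)) = a i i"
proof -
  let ?v = "(\<lambda>_. 0)(i := 1) :: nat \<Rightarrow> complex"
  have inner: "(\<Sum>l<p. a k l * ?v l * cnj (?v k)) = a k i * cnj (?v k)" for k
  proof -
    have "(\<Sum>l<p. a k l * ?v l * cnj (?v k)) = (\<Sum>l\<in>{i}. a k l * ?v l * cnj (?v k))"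
      using assms by (intro sum.mono_neutral_right) auto
    then show ?thesis by simp
  qed
  have "qform p a ?v = (\<Sum>k<p. a k i * cnj (?v k))"
    unfolding qform_def inner ..
  also have "\<dots> = (\<Sum>k\<in>{i}. a k i * cnj (?v k))"
    using assms by (intro sum.mono_neutral_right) auto
  finally show ?thesis by simp
qed

lemma qform_herm:
  assumes "\<And>v. Im (qform p a v) = 0" "i < p" "j < p"
  shows "a i j = cnj (a j i)"
proof -
  have d: "Im (a k k) = 0" if "k < p" for k
    using assms(1)[of "(\<lambda>_. 0)(k := 1)"] qform_one[OF that, of a] by simp
  show ?thesis
  proof (cases "i = j")
    case True
    then show ?thesis using d assms by (simp add: complex_eq_iff)
  next
    case False
    note q = qform_two[OF assms(2,3) False, of a]
    show ?thesis
      using assms(1)[of "(\<lambda>_. 0)(i := 1, j := 1)"] assms(1)[of "(\<lambda>_. 0)(i := 1, j := \<i>)"]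
        d[OF assms(2)] d[OF assms(3)]
      unfolding q by (simp add: complex_eq_iff)
  qed
qed

lemma qform_zero:
  assumes "\<And>v. qform p a v = 0" "i < p" "j < p"
  shows "a i j = 0"
proof -
  have d: "a k k = 0" if "k < p" for k
    using assms(1)[of "(\<lambda>_. 0)(k := 1)"] qform_one[OF that, of a] by simp
  show ?thesis
  proof (cases "i = j")
    case True
    then show ?thesis using d assms by simp
  next
    case False
    note q = qform_two[OF assms(2,3) False, of a]
    show ?thesis
      using assms(1)[of "(\<lambda>_. 0)(i := 1, j := 1)"] assms(1)[of "(\<lambda>_. 0)(i := 1, j := \<i>)"]
        d[OF assms(2)] d[OF assms(3)]
      unfolding q by (simp add: complex_eq_iff)
  qed
qed

lemma qform_add: "qform p (\<lambda>i j. a i j + b i j) v = qform p a v + qform p b v"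
  by (simp add: qform_def algebra_simps sum.distrib)

lemma qform_scale: "qform p (\<lambda>i j. c * a i j) v = c * qform p a v"
  by (simp add: qform_def algebra_simps sum_distrib_left)

lemma qform_diag:
  "qform p (\<lambda>i j. if i = j then c else 0) v = c * of_real (\<Sum>i<p. (cmod (v i))\<^sup>2)"
proof -
  have "(\<Sum>j<p. (if i = j then c else 0) * v j * cnj (v i)) = c * of_real ((cmod (v i))\<^sup>2)"
    if "i < p" for i
  proof -
    have "(\<Sum>j<p. (if i = j then c else 0) * v j * cnj (v i)) =
        (\<Sum>j<p. if i = j then c * v j * cnj (v i) else 0)"
      by (intro sum.cong) auto
    also have "\<dots> = c * v i * cnj (v i)"
      using that by simp
    finally show ?thesis using complex_norm_square[of "v i"] by (simp add: mult.assoc)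
  qed
  then show ?thesis by (simp add: qform_def sum_distrib_left)
qed

lemma qform_compress:
  "qform q (\<lambda>i j. \<Sum>k<p. \<Sum>l<p. cnj (x k i) * x l j * a k l) v =
    qform p a (\<lambda>k. \<Sum>i<q. x k i * v i)"
proof -
  have "qform p a (\<lambda>k. \<Sum>i<q. x k i * v i) =
      (\<Sum>k<p. \<Sum>l<p. \<Sum>i<q. \<Sum>j<q. a k l * (x l j * v j) * cnj (x k i * v i))"
    unfolding qform_def
    by (simp add: sum_distrib_left sum_distrib_right)
  also have "\<dots> = (\<Sum>k<p. \<Sum>i<q. \<Sum>l<p. \<Sum>j<q. a k l * (x l j * v j) * cnj (x k i * v i))"
    by (intro sum.cong sum.swap refl)
  also have "\<dots> = (\<Sum>k<p. \<Sum>i<q. \<Sum>j<q. \<Sum>l<p. a k l * (x l j * v j) * cnj (x k i * v i))"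
    by (intro sum.cong sum.swap refl)
  also have "\<dots> = (\<Sum>i<q. \<Sum>k<p. \<Sum>j<q. \<Sum>l<p. a k l * (x l j * v j) * cnj (x k i * v i))"
    by (rule sum.swap)
  also have "\<dots> = (\<Sum>i<q. \<Sum>j<q. \<Sum>k<p. \<Sum>l<p. a k l * (x l j * v j) * cnj (x k i * v i))"
    by (intro sum.cong sum.swap refl)
  also have "\<dots> = qform q (\<lambda>i j. \<Sum>k<p. \<Sum>l<p. cnj (x k i) * x l j * a k l) v"
    unfolding qform_def
    by (simp add: sum_distrib_left sum_distrib_right mult_ac)
  finally show ?thesis ..
qed

lemma qform_bound:
  assumes "\<And>i j. i < p \<Longrightarrow> j < p \<Longrightarrow> cmod (a i j) \<le> M" "M \<ge> 0"
  shows "cmod (qform p a v) \<le> real p * M * (\<Sum>i<p. (cmod (v i))\<^sup>2)"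
proof -
  have "cmod (qform p a v) \<le> (\<Sum>i<p. \<Sum>j<p. cmod (a i j * v j * cnj (v i)))"
    unfolding qform_def by (intro order.trans[OF norm_sum] sum_mono norm_sum)
  also have "\<dots> \<le> (\<Sum>i<p. \<Sum>j<p. M * (((cmod (v i))\<^sup>2 + (cmod (v j))\<^sup>2) / 2))"
  proof (intro sum_mono)
    fix i j assume ij: "i \<in> {..<p}" "j \<in> {..<p}"
    have "cmod (v j) * cmod (v i) \<le> ((cmod (v i))\<^sup>2 + (cmod (v j))\<^sup>2) / 2"
      using sum_squares_bound[of "cmod (v i)" "cmod (v j)"] by (simp add: mult_ac)
    then have "cmod (a i j) * (cmod (v j) * cmod (v i)) \<le>
        M * (((cmod (v i))\<^sup>2 + (cmod (v j))\<^sup>2) / 2)"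
      using assms ij by (intro mult_mono) auto
    then show "cmod (a i j * v j * cnj (v i)) \<le> M * (((cmod (v i))\<^sup>2 + (cmod (v j))\<^sup>2) / 2)"
      by (simp add: norm_mult mult.assoc)
  qed
  also have "\<dots> = real p * M * (\<Sum>i<p. (cmod (v i))\<^sup>2)"
    by (simp add: sum_distrib_left[symmetric] sum_divide_distrib[symmetric] sum.distrib algebra_simps)
  finally show ?thesis .
qed

lemma sum_fun_apply: "(\<Sum>i\<in>I. f i) z = (\<Sum>i\<in>I. f i z :: complex)"
  by (induction I rule: infinite_finite_induct) auto

lemma C_circle_cone_iff:
  "F \<in> os_cone C_circle p \<longleftrightarrow> F \<in> os_mats C_circle p \<and>
    (\<forall>z\<in>circle. \<forall>v. 0 \<le> qform p (\<lambda>i j. (F $$ (i, j)) z) v)"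
proof -
  have "psd (map_mat (\<lambda>f. f z) F) \<longleftrightarrow> (\<forall>v. 0 \<le> qform p (\<lambda>i j. (F $$ (i, j)) z) v)"
    if "F \<in> carrier_mat p p" for z :: complex
  proof -
    have "qform p (\<lambda>i j. map_mat (\<lambda>f. f z) F $$ (i, j)) v = qform p (\<lambda>i j. (F $$ (i, j)) z) v" for v
      using that by (intro qform_cong) auto
    then show ?thesis
      using that by (subst psd_iff[of _ p]) auto
  qed
  then show ?thesis
    by (auto simp: C_circle_def os_mats_def)
qed

lemma vector_space_C_circle: "vector_space (os_scale C_circle)"
  by unfold_locales (auto simp: C_circle_def fun_eq_iff algebra_simps)

lemma circle_cont_add: "f \<in> circle_cont \<Longrightarrow> g \<in> circle_cont \<Longrightarrow> f + g \<in> circle_cont"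
  by (auto simp: circle_cont_def plus_fun_def intro!: continuous_intros)

lemma circle_cont_diff: "f \<in> circle_cont \<Longrightarrow> g \<in> circle_cont \<Longrightarrow> f - g \<in> circle_cont"
  by (auto simp: circle_cont_def fun_diff_def intro!: continuous_intros)

lemma circle_cont_scale: "f \<in> circle_cont \<Longrightarrow> (\<lambda>z. c * f z) \<in> circle_cont"
  by (auto simp: circle_cont_def intro!: continuous_intros)

lemma circle_cont_zero: "0 \<in> circle_cont"
  by (auto simp: circle_cont_def zero_fun_def)

lemma circle_cont_sum: "(\<And>i. i \<in> I \<Longrightarrow> f i \<in> circle_cont) \<Longrightarrow> sum f I \<in> circle_cont"
  by (induction I rule: infinite_finite_induct)
    (auto intro: circle_cont_add simp: circle_cont_zero)

lemma circle_cont_star: "f \<in> circle_cont \<Longrightarrow> (\<lambda>z. cnj (f z)) \<in> circle_cont"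
  by (auto simp: circle_cont_def intro!: continuous_intros)

lemma circle_cont_unit: "(\<lambda>z. if z \<in> circle then 1 else 0) \<in> circle_cont"
proof -
  have "continuous_on circle (\<lambda>z. if z \<in> circle then 1 else 0 :: complex)
      \<longleftrightarrow> continuous_on circle (\<lambda>z. 1 :: complex)"
    by (intro continuous_on_cong) auto
  then show ?thesis by (auto simp: circle_cont_def)
qed

lemma circle_cont_bounded:
  assumes "f \<in> circle_cont"
  shows "\<exists>M. \<forall>z\<in>circle. cmod (f z) \<le> M"
proof -
  have "compact (f ` circle)"
    using assms by (intro compact_continuous_image) (auto simp: circle_cont_def)
  then have "bounded (f ` circle)" by (rule compact_imp_bounded)
  then show ?thesis by (auto simp: bounded_iff)
qed

lemma os_unit_mat_C_circle:
  assumes "i < p" "j < p" "z \<in> circle"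
  shows "(os_unit_mat C_circle p r $$ (i, j)) z = (if i = j then complex_of_real r else 0)"
  using assms by (simp add: os_unit_mat_def C_circle_def)

lemma os_unit_mat_C_circle_mats: "os_unit_mat C_circle p r \<in> os_mats C_circle p"
  using circle_cont_scale[OF circle_cont_unit, of "complex_of_real r"] circle_cont_zero
  by (auto simp: os_unit_mat_def os_mats_def C_circle_def)

lemma qform_add_unit:
  assumes "z \<in> circle" "A \<in> carrier_mat p p"
  shows "qform p (\<lambda>i j. ((os_unit_mat C_circle p r + A) $$ (i, j)) z) v =
    complex_of_real (r * (\<Sum>i<p. (cmod (v i))\<^sup>2)) + qform p (\<lambda>i j. (A $$ (i, j)) z) v"
proof -
  have "qform p (\<lambda>i j. ((os_unit_mat C_circle p r + A) $$ (i, j)) z) v =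
      qform p (\<lambda>i j. (if i = j then complex_of_real r else 0) + (A $$ (i, j)) z) v"
    using assms by (intro qform_cong) (auto simp: os_unit_mat_C_circle)
  then show ?thesis
    by (simp add: qform_add qform_diag)
qed

lemma operator_system_C_circle: "operator_system C_circle"
proof -
  interpret vector_space "os_scale C_circle" by (rule vector_space_C_circle)
  have space: "os_space C_circle = circle_cont" and star: "os_star C_circle = (\<lambda>f z. cnj (f z))"
    and unit: "os_unit C_circle = (\<lambda>z. if z \<in> circle then 1 else 0)"
    and scale: "os_scale C_circle = (\<lambda>c f z. c * f z)"
    by (simp_all add: C_circle_def)
  show ?thesis
  proof
    show "subspace (os_space C_circle)"
      by (rule subspaceI) (auto simp: space scale circle_cont_zero circle_cont_add circle_cont_scale)
  next
    fix p
    show "os_cone C_circle p \<subseteq> os_herm C_circle p"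
    proof
      fix A assume A: "A \<in> os_cone C_circle p"
      have "(A $$ (i, j)) z = cnj ((A $$ (j, i)) z)" if "i < p" "j < p" for i j z
      proof (cases "z \<in> circle")
        case True
        have "Im (qform p (\<lambda>i j. (A $$ (i, j)) z) v) = 0" for v
          using A True by (auto simp: C_circle_cone_iff less_eq_complex_def)
        from qform_herm[OF this that] show ?thesis .
      next
        case False
        then show ?thesis
          using A that by (auto simp: C_circle_cone_iff os_mats_def space circle_cont_def)
      qed
      then have "A $$ (i, j) = os_star C_circle (A $$ (j, i))" if "i < p" "j < p" for i j
        unfolding star using that by blast
      moreover have "A \<in> os_mats C_circle p"
        using A unfolding C_circle_cone_iff by blast
      ultimately show "A \<in> os_herm C_circle p"
        unfolding os_herm_def by blast
    qed
  next
    fix A B p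
    assume AB: "A \<in> os_cone C_circle p" "B \<in> os_cone C_circle p"
    then have c: "A \<in> carrier_mat p p" "B \<in> carrier_mat p p"
      by (auto simp: C_circle_cone_iff os_mats_def)
    have "qform p (\<lambda>i j. ((A + B) $$ (i, j)) z) v =
        qform p (\<lambda>i j. (A $$ (i, j)) z) v + qform p (\<lambda>i j. (B $$ (i, j)) z) v" for z v
      unfolding qform_add[symmetric] using c by (intro qform_cong) auto
    with AB c show "A + B \<in> os_cone C_circle p"
      by (auto simp: C_circle_cone_iff os_mats_def space intro: circle_cont_add)
  next
    fix A p and r :: real
    assume A: "A \<in> os_cone C_circle p" "0 \<le> r"
    then have c: "A \<in> carrier_mat p p"
      by (auto simp: C_circle_cone_iff os_mats_def)
    have "qform p (\<lambda>i j. (map_mat (os_scale C_circle (complex_of_real r)) A $$ (i, j)) z) v =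
        complex_of_real r * qform p (\<lambda>i j. (A $$ (i, j)) z) v" for z v
      unfolding qform_scale[symmetric] using c by (intro qform_cong) (auto simp: scale)
    moreover have "0 \<le> complex_of_real r * x" if "0 \<le> x" for x
      using that A(2) by (auto simp: less_eq_complex_def)
    ultimately show "map_mat (os_scale C_circle (complex_of_real r)) A \<in> os_cone C_circle p"
      using A c by (auto simp: C_circle_cone_iff os_mats_def space scale intro: circle_cont_scale)
  next
    fix A p
    assume A: "A \<in> os_cone C_circle p" "- A \<in> os_cone C_circle p"
    then have c: "A \<in> carrier_mat p p"
      by (auto simp: C_circle_cone_iff os_mats_def)
    have m: "qform p (\<lambda>i j. ((- A) $$ (i, j)) z) v = - qform p (\<lambda>i j. (A $$ (i, j)) z) v" for z v
    proof -
      have "qform p (\<lambda>i j. ((- A) $$ (i, j)) z) v = qform p (\<lambda>i j. (- 1) * (A $$ (i, j)) z) v"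
        using c by (intro qform_cong) auto
      then show ?thesis unfolding qform_scale by simp
    qed
    have "(A $$ (i, j)) z = 0" if ij: "i < p" "j < p" for i j z
    proof (cases "z \<in> circle")
      case True
      have "qform p (\<lambda>i j. (A $$ (i, j)) z) v = 0" for v
      proof -
        have "0 \<le> qform p (\<lambda>i j. (A $$ (i, j)) z) v" "0 \<le> - qform p (\<lambda>i j. (A $$ (i, j)) z) v"
          using A True unfolding C_circle_cone_iff m by auto
        then show ?thesis by (simp add: less_eq_complex_def complex_eq_iff)
      qed
      from qform_zero[OF this ij] show ?thesis .
    next
      case False
      then show ?thesis
        using A ij by (auto simp: C_circle_cone_iff os_mats_def space circle_cont_def)
    qed
    then show "A = 0\<^sub>m p p"
      using c by (intro eq_matI) (auto simp: fun_eq_iff)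
  next
    fix A p q and X :: "complex mat"
    assume A: "A \<in> os_cone C_circle p" and X: "X \<in> carrier_mat p q"
    have "qform q (\<lambda>i j. (os_compress C_circle X A $$ (i, j)) z) v =
        qform q (\<lambda>i j. \<Sum>k<p. \<Sum>l<p. cnj (X $$ (k, i)) * X $$ (l, j) * (A $$ (k, l)) z) v" for z v
      using X by (intro qform_cong) (auto simp: os_compress_def sum_fun_apply scale)
    then have "0 \<le> qform q (\<lambda>i j. (os_compress C_circle X A $$ (i, j)) z) v" if "z \<in> circle" for z v
      using that A by (simp add: qform_compress C_circle_cone_iff)
    then show "os_compress C_circle X A \<in> os_cone C_circle q"
      using A X
      by (auto simp: C_circle_cone_iff os_mats_def space scale os_compress_def
          intro!: circle_cont_sum circle_cont_scale)
  next
    fix A p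
    assume A: "A \<in> os_herm C_circle p"
    then have mats: "A \<in> os_mats C_circle p"
      unfolding os_herm_def by blast
    then have c: "A \<in> carrier_mat p p"
      unfolding os_mats_def by blast
    have "\<exists>M. \<forall>z\<in>circle. cmod ((A $$ (i, j)) z) \<le> M" if "i < p" "j < p" for i j
      using circle_cont_bounded that mats by (auto simp: os_mats_def space)
    then obtain M where M: "cmod ((A $$ (i, j)) z) \<le> M i j"
      if "i < p" "j < p" "z \<in> circle" for i j z
      by metis
    define K where "K = (\<Sum>i<p. \<Sum>j<p. \<bar>M i j\<bar>)"
    have K0: "K \<ge> 0" by (auto simp: K_def intro!: sum_nonneg)
    have K: "cmod ((A $$ (i, j)) z) \<le> K" if "i < p" "j < p" "z \<in> circle" for i j z
    proof -
      have "\<bar>M i j\<bar> \<le> (\<Sum>j<p. \<bar>M i j\<bar>)"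
        using that by (intro member_le_sum[of j "{..<p}" "\<lambda>j. \<bar>M i j\<bar>"]) auto
      also have "\<dots> \<le> K"
        unfolding K_def using that
        by (intro member_le_sum[of i "{..<p}" "\<lambda>i. \<Sum>j<p. \<bar>M i j\<bar>"]) (auto intro!: sum_nonneg)
      finally show ?thesis using M[OF that] by linarith
    qed
    define r where "r = real p * K + 1"
    have "0 \<le> qform p (\<lambda>i j. ((os_unit_mat C_circle p r - A) $$ (i, j)) z) v"
      if z: "z \<in> circle" for z v
    proof -
      let ?N = "\<Sum>i<p. (cmod (v i))\<^sup>2" and ?q = "qform p (\<lambda>i j. (A $$ (i, j)) z) v"
      have "qform p (\<lambda>i j. ((os_unit_mat C_circle p r - A) $$ (i, j)) z) v =
          qform p (\<lambda>i j. (if i = j then complex_of_real r else 0) + (-1) * (A $$ (i, j)) z) v"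
        using c z by (intro qform_cong) (auto simp: os_unit_mat_C_circle)
      also have "\<dots> = complex_of_real (r * ?N) - ?q"
        unfolding qform_add qform_scale qform_diag by simp
      finally have eq: "qform p (\<lambda>i j. ((os_unit_mat C_circle p r - A) $$ (i, j)) z) v =
        complex_of_real (r * ?N) - ?q" .
      have "cmod ?q \<le> real p * K * ?N"
        using K z K0 by (intro qform_bound) auto
      also have "\<dots> \<le> r * ?N"
        by (auto simp: r_def algebra_simps intro!: sum_nonneg)
      finally have re: "Re ?q \<le> r * ?N"
        using complex_Re_le_cmod[of ?q] by linarith
      have "cnj ?q = (\<Sum>i<p. \<Sum>j<p. cnj ((A $$ (i, j)) z) * cnj (v j) * v i)"
        by (simp add: qform_def)
      also have "\<dots> = (\<Sum>i<p. \<Sum>j<p. (A $$ (j, i)) z * v i * cnj (v j))"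
      proof (intro sum.cong refl)
        fix i j assume "i \<in> {..<p}" "j \<in> {..<p}"
        then have "A $$ (j, i) = (\<lambda>z. cnj ((A $$ (i, j)) z))"
          using A unfolding os_herm_def star by blast
        then have "(A $$ (j, i)) z = cnj ((A $$ (i, j)) z)"
          by (rule fun_cong)
        then show "cnj ((A $$ (i, j)) z) * cnj (v j) * v i = (A $$ (j, i)) z * v i * cnj (v j)"
          by (simp add: mult_ac)
      qed
      also have "\<dots> = ?q" unfolding qform_def by (rule sum.swap)
      finally have "Im ?q = 0" by (simp add: complex_eq_iff)
      with re show ?thesis unfolding eq by (simp add: less_eq_complex_def)
    qed
    moreover have "os_unit_mat C_circle p r - A \<in> os_mats C_circle p"
      using mats os_unit_mat_C_circle_mats[of p r] c
      by (auto simp: os_mats_def space intro: circle_cont_diff)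
    moreover have "r > 0"
      using K0 by (simp add: r_def add_nonneg_pos)
    ultimately show "\<exists>r>0. os_unit_mat C_circle p r - A \<in> os_cone C_circle p"
      by (auto simp: C_circle_cone_iff)
  next
    fix A p
    assume A: "A \<in> os_mats C_circle p"
      and r: "\<And>r. r > 0 \<Longrightarrow> os_unit_mat C_circle p r + A \<in> os_cone C_circle p"
    have c: "A \<in> carrier_mat p p" using A by (simp add: os_mats_def)
    have "0 \<le> qform p (\<lambda>i j. (A $$ (i, j)) z) v" if z: "z \<in> circle" for z v
    proof -
      let ?N = "\<Sum>i<p. (cmod (v i))\<^sup>2" and ?q = "qform p (\<lambda>i j. (A $$ (i, j)) z) v"
      have *: "0 \<le> complex_of_real (r * ?N) + ?q" if "r > 0" for r
        using r[OF that] z unfolding C_circle_cone_iff qform_add_unit[OF z c, symmetric] by blast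
      have im: "Im ?q = 0" using *[of 1] by (simp add: less_eq_complex_def)
      have N: "?N \<ge> 0" by (intro sum_nonneg) auto
      have "0 \<le> Re ?q"
      proof (rule field_le_epsilon)
        fix e :: real assume e: "e > 0"
        have "e / (?N + 1) > 0" using e N by simp
        from *[OF this] have "0 \<le> e / (?N + 1) * ?N + Re ?q"
          by (simp add: less_eq_complex_def)
        moreover have "e / (?N + 1) * ?N \<le> e"
          using e N by (simp add: field_simps)
        ultimately show "0 \<le> Re ?q + e" by linarith
      qed
      with im show ?thesis by (simp add: less_eq_complex_def)
    qed
    with A show "A \<in> os_cone C_circle p" by (simp add: C_circle_cone_iff)
  next
    show "os_unit C_circle \<in> os_space C_circle"
      unfolding space unit by (rule circle_cont_unit)
  qed (auto simp: space star unit scale circle_cont_star fun_eq_iff)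
qed

lemma operator_system_os_sub:
  assumes "operator_system S" "module.subspace (os_scale S) V" "V \<subseteq> os_space S"
    and star: "\<And>x. x \<in> V \<Longrightarrow> os_star S x \<in> V" and unit: "os_unit S \<in> V"
  shows "operator_system (os_sub S V)"
proof -
  interpret operator_system S by fact
  have V: "subspace V" using assms by simp
  have fields: "os_space (os_sub S V) = V" "os_scale (os_sub S V) = os_scale S"
    "os_star (os_sub S V) = os_star S" "os_unit (os_sub S V) = os_unit S"
    and cone: "\<And>p. os_cone (os_sub S V) p =
      {A \<in> os_cone S p. \<forall>i<p. \<forall>j<p. A $$ (i, j) \<in> V}"
    by (simp_all add: os_sub_def)
  have um: "os_unit_mat (os_sub S V) = os_unit_mat S"
    unfolding os_unit_mat_def[abs_def] fields ..
  have cm: "os_compress (os_sub S V) = os_compress S"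
    unfolding os_compress_def[abs_def] fields ..
  have umV: "os_unit_mat S p r $$ (i, j) \<in> V" if "i < p" "j < p" for p r i j
    using that V unit by (auto simp: os_unit_mat_def subspace_0 subspace_scale)
  have umc: "os_unit_mat S p r \<in> carrier_mat p p" for p r
    by (simp add: os_unit_mat_def)
  have mats: "os_mats (os_sub S V) p = {A \<in> os_mats S p. \<forall>i<p. \<forall>j<p. A $$ (i, j) \<in> V}" for p
    using assms(3) by (auto simp: os_mats_def fields)
  have herm: "os_herm (os_sub S V) p = {A \<in> os_herm S p. \<forall>i<p. \<forall>j<p. A $$ (i, j) \<in> V}" for p
    unfolding os_herm_def mats fields by blast
  have hc: "A \<in> carrier_mat p p" if "A \<in> os_herm S p" for A p
    using that unfolding os_herm_def os_mats_def by blast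
  have cc: "A \<in> carrier_mat p p" if "A \<in> os_cone S p" for A p
    using that cone_herm hc by blast
  interpret V: vector_space "os_scale (os_sub S V)"
    unfolding fields by (rule vector_space_axioms)
  show ?thesis
  proof
    show "V.subspace (os_space (os_sub S V))"
      using V by (simp add: fields)
  next
    fix p show "os_cone (os_sub S V) p \<subseteq> os_herm (os_sub S V) p"
      using cone_herm by (auto simp: cone herm)
  next
    fix A B p assume "A \<in> os_cone (os_sub S V) p" "B \<in> os_cone (os_sub S V) p"
    then show "A + B \<in> os_cone (os_sub S V) p"
      using cc[of A p] cc[of B p] by (auto simp: cone cone_add intro: subspace_add[OF V])
  next
    fix A p and r :: real
    assume "A \<in> os_cone (os_sub S V) p" "0 \<le> r"
    then show "map_mat (os_scale (os_sub S V) (complex_of_real r)) A \<in> os_cone (os_sub S V) p"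
      using cc[of A p] by (auto simp: cone fields cone_scale intro: subspace_scale[OF V])
  next
    fix A p assume "A \<in> os_cone (os_sub S V) p" "- A \<in> os_cone (os_sub S V) p"
    then show "A = 0\<^sub>m p p" by (auto simp: cone intro: cone_proper)
  next
    fix A p q and X :: "complex mat"
    assume A: "A \<in> os_cone (os_sub S V) p" and X: "X \<in> carrier_mat p q"
    have "os_compress S X A $$ (i, j) \<in> V" if "i < q" "j < q" for i j
      using that A X by (auto simp: os_compress_def cone intro!: subspace_sum[OF V] subspace_scale[OF V])
    then show "os_compress (os_sub S V) X A \<in> os_cone (os_sub S V) q"
      using A X by (auto simp: cm cone intro: cone_compress)
  next
    fix A p assume A: "A \<in> os_herm (os_sub S V) p"
    then obtain r where "r > 0" "os_unit_mat S p r - A \<in> os_cone S p"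
      using order_unit[of A p] by (auto simp: herm)
    moreover have "A \<in> carrier_mat p p" using A hc unfolding herm by blast
    ultimately show "\<exists>r>0. os_unit_mat (os_sub S V) p r - A \<in> os_cone (os_sub S V) p"
      using A umV umc[of p r] by (auto simp: um cone herm intro!: exI[of _ r] subspace_diff[OF V])
  next
    fix A p assume "A \<in> os_mats (os_sub S V) p"
      "\<And>r. r > 0 \<Longrightarrow> os_unit_mat (os_sub S V) p r + A \<in> os_cone (os_sub S V) p"
    then show "A \<in> os_cone (os_sub S V) p"
      by (auto simp: um cone mats intro: archimedean)
  qed (use assms(3) in \<open>auto simp: fields star unit unit_star star_star star_add star_scale subset_iff\<close>)
qed

lemma circle_char_cont: "circle_char j \<in> circle_cont"
proof -
  have "continuous_on circle (circle_char j) \<longleftrightarrow> continuous_on circle (\<lambda>z. z powi j)"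
    by (intro continuous_on_cong) (auto simp: circle_char_def)
  then show ?thesis
    by (auto simp: circle_cont_def circle_char_def intro!: continuous_intros)
qed

lemma cnj_circle_char: "cnj (circle_char j z) = circle_char (- j) z"
proof (cases "z \<in> circle")
  case True
  then have "z * cnj z = 1"
    using complex_norm_square[of z] by simp
  then have "cnj z = inverse z"
    by (metis inverse_unique)
  then have "cnj (z powi j) = inverse z powi j"
    by (cases "j \<ge> 0") (simp_all add: power_int_def)
  also have "\<dots> = z powi (- j)"
    by (simp only: power_int_inverse power_int_minus)
  finally show ?thesis
    using True by (simp only: circle_char_def if_True)
qed (simp add: circle_char_def)

lemma trig_polyI:
  "(\<And>z. f z = (\<Sum>l\<in>{- int n + 1..int n - 1}. \<alpha> l * circle_char l z)) \<Longrightarrow> f \<in> trig_poly n"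
  unfolding trig_poly_def by blast

lemma trig_polyE:
  assumes "f \<in> trig_poly n"
  obtains \<alpha> where "\<And>z. f z = (\<Sum>l\<in>{- int n + 1..int n - 1}. \<alpha> l * circle_char l z)"
  using assms unfolding trig_poly_def by auto

proposition operator_system_C_circle_n:
  assumes "n \<ge> 1"
  shows "operator_system (C_circle_n n)"
  unfolding C_circle_n_def
proof (rule operator_system_os_sub[OF operator_system_C_circle])
  interpret vector_space "os_scale C_circle" by (rule vector_space_C_circle)
  let ?I = "{- int n + 1..int n - 1}"
  have fields: "os_space C_circle = circle_cont" "os_scale C_circle = (\<lambda>c f z. c * f z)"
    "os_star C_circle = (\<lambda>f z. cnj (f z))"
    "os_unit C_circle = (\<lambda>z. if z \<in> circle then 1 else 0)"
    by (simp_all add: C_circle_def)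
  show "subspace (trig_poly n)"
  proof (rule subspaceI)
    show "0 \<in> trig_poly n"
      by (rule trig_polyI[where \<alpha> = "\<lambda>_. 0"]) simp
  next
    fix f g assume "f \<in> trig_poly n" "g \<in> trig_poly n"
    then obtain a b where ab: "\<And>z. f z = (\<Sum>l\<in>?I. a l * circle_char l z)"
      "\<And>z. g z = (\<Sum>l\<in>?I. b l * circle_char l z)"
      by (metis trig_polyE)
    show "f + g \<in> trig_poly n"
      by (rule trig_polyI[where \<alpha> = "\<lambda>l. a l + b l"])
        (simp only: plus_fun_def ab distrib_right sum.distrib)
  next
    fix c f assume "f \<in> trig_poly n"
    then obtain a where a: "\<And>z. f z = (\<Sum>l\<in>?I. a l * circle_char l z)"
      by (metis trig_polyE)
    show "os_scale C_circle c f \<in> trig_poly n"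
      by (rule trig_polyI[where \<alpha> = "\<lambda>l. c * a l"])
        (simp only: fields a sum_distrib_left mult.assoc)
  qed
  show "trig_poly n \<subseteq> os_space C_circle"
  proof
    fix f assume "f \<in> trig_poly n"
    then obtain a where a: "\<And>z. f z = (\<Sum>l\<in>?I. a l * circle_char l z)"
      by (metis trig_polyE)
    have "f = (\<Sum>l\<in>?I. (\<lambda>z. a l * circle_char l z))"
      by (rule ext) (simp only: a sum_fun_apply)
    also have "\<dots> \<in> circle_cont"
      by (intro circle_cont_sum circle_cont_scale circle_char_cont)
    finally show "f \<in> os_space C_circle"
      by (simp only: fields)
  qed
  show "os_star C_circle f \<in> trig_poly n" if "f \<in> trig_poly n" for f
  proof -
    from that obtain a where a: "\<And>z. f z = (\<Sum>l\<in>?I. a l * circle_char l z)"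
      by (metis trig_polyE)
    have "os_star C_circle f z = (\<Sum>l\<in>?I. cnj (a (- l)) * circle_char l z)" for z
    proof -
      have "os_star C_circle f z = (\<Sum>l\<in>?I. cnj (a l) * circle_char (- l) z)"
        by (simp only: fields a cnj_sum complex_cnj_mult cnj_circle_char)
      also have "\<dots> = (\<Sum>l\<in>?I. cnj (a (- l)) * circle_char l z)"
        by (rule sum.reindex_bij_witness[of _ uminus uminus]) auto
      finally show ?thesis .
    qed
    then show ?thesis by (rule trig_polyI)
  qed
  have "os_unit C_circle z = (\<Sum>l\<in>?I. (if l = 0 then 1 else 0) * circle_char l z)" for z
  proof -
    have "(\<Sum>l\<in>?I. (if l = 0 then 1 else 0) * circle_char l z) =
        (\<Sum>l\<in>{0}. (if l = 0 then 1 else 0) * circle_char l z)"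
      using assms by (intro sum.mono_neutral_right) auto
    then show ?thesis by (simp add: circle_char_def fields)
  qed
  then show "os_unit C_circle \<in> trig_poly n" by (rule trig_polyI)
qed

end

theory Submission
  imports Defs "HOL-Library.Real_Mod"
begin

text \<open>
  The matrix of characters has the rank one values \<open>u(z) u(z)\<^sup>*\<close>, \<open>u(z) = (1, z, \<dots>, z\<^sup>n\<^sup>-\<^sup>1)\<close>.
  Conversely, complete positivity follows once every positive \<open>F\<close> is a sum of compressions of this
  matrix, which is the operator-valued Fejer-Riesz theorem. The latter is obtained from Schur
  complements. Positivity of \<open>F\<close> makes all its finite block Toeplitz forms positive. Minimising
  these forms over all but the first \<open>n - 1\<close> blocks of variables gives a decreasing sequence of
  positive forms, with limit \<open>S\<close>. Since \<open>F\<close> has degree less than \<open>n\<close>, the first block of variables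
  interacts only with the next \<open>n - 1\<close>, so on \<open>n\<close> blocks
  \<open>R(x\<^sub>0, \<dots>) + S(x\<^sub>1, \<dots>, x\<^sub>n\<^sub>-\<^sub>1) - S(x\<^sub>0, \<dots>, x\<^sub>n\<^sub>-\<^sub>2) \<ge> 0\<close>, where \<open>R\<close> collects the Toeplitz terms
  that involve \<open>x\<^sub>0\<close>. Along block diagonals the two copies of \<open>S\<close> cancel, and \<open>R\<close> sums to the
  coefficients of \<open>F\<close>; hence writing this form as a sum of rank one forms factorises \<open>F\<close>.
\<close>

section \<open>Positive semidefinite forms\<close>

abbreviation psd_form :: "nat \<Rightarrow> (nat \<Rightarrow> nat \<Rightarrow> complex) \<Rightarrow> bool" where
  "psd_form m a \<equiv> \<forall>v. 0 \<le> qform m a v"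

section \<open>Algebra of quadratic forms\<close>

lemma qform_Suc:
  "qform (Suc m) a v = qform m a v + (\<Sum>i<m. a i m * cnj (v i)) * v m
    + cnj (v m) * (\<Sum>j<m. a m j * v j) + a m m * v m * cnj (v m)"
  by (simp add: qform_def sum.distrib sum_distrib_left sum_distrib_right algebra_simps)

lemma qform_sum: "qform p (\<lambda>i j. \<Sum>w\<in>W. a w i j) v = (\<Sum>w\<in>W. qform p (a w) v)"
  by (induction W rule: infinite_finite_induct) (simp_all add: qform_add, simp_all add: qform_def)

lemma qform_diff: "qform p (\<lambda>i j. a i j - b i j) v = qform p a v - qform p b v"
  by (simp add: qform_def algebra_simps sum_subtractf)

text \<open>The condition is on the whole product so that it covers both vectors padded with zeros
  and forms with vanishing entries.\<close>

lemma qform_support: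
  assumes "m \<le> N"
    and "\<And>i j. i < N \<Longrightarrow> j < N \<Longrightarrow> m \<le> i \<or> m \<le> j \<Longrightarrow> a i j * v j * cnj (v i) = 0"
  shows "qform N a v = qform m a v"
proof -
  have "(\<Sum>j<N. a i j * v j * cnj (v i)) = (\<Sum>j<m. a i j * v j * cnj (v i))" if "i < N" for i
    using assms that by (intro sum.mono_neutral_right) auto
  then have "qform N a v = (\<Sum>i<N. \<Sum>j<m. a i j * v j * cnj (v i))"
    unfolding qform_def by (intro sum.cong[OF refl]) auto
  also have "\<dots> = qform m a v"
    unfolding qform_def using assms by (intro sum.mono_neutral_right) (auto intro!: sum.neutral)
  finally show ?thesis .
qed

lemma qform_restrict:
  assumes "m \<le> N"
  shows "qform N (\<lambda>i j. if i < m \<and> j < m then a i j else 0) v = qform m a v"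
  using assms by (subst qform_support[of m]) (auto intro!: qform_cong)

lemma qform_shift:
  "qform (m + p) (\<lambda>i j. if p \<le> i \<and> p \<le> j then a (i - p) (j - p) else 0) v =
    qform m a (\<lambda>i. v (i + p))"
proof -
  have shift: "(\<Sum>i<m + p. if p \<le> i then f (i - p) else 0) = (\<Sum>i<m. f i)"
    for f :: "nat \<Rightarrow> complex"
  proof -
    have "(\<Sum>i<m + p. if p \<le> i then f (i - p) else 0) = (\<Sum>i\<in>{p..<m + p}. f (i - p))"
      by (intro sum.mono_neutral_cong_right) auto
    also have "\<dots> = (\<Sum>i<m. f i)"
      by (rule sum.reindex_bij_witness[of _ "\<lambda>i. i + p" "\<lambda>i. i - p"]) auto
    finally show ?thesis .
  qed
  have "qform (m + p) (\<lambda>i j. if p \<le> i \<and> p \<le> j then a (i - p) (j - p) else 0) v =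
     (\<Sum>i<m + p. if p \<le> i then (\<Sum>j<m + p. if p \<le> j
        then a (i - p) (j - p) * v (j - p + p) * cnj (v (i - p + p)) else 0) else 0)"
    unfolding qform_def by (intro sum.cong refl) (auto intro!: sum.cong)
  also have "\<dots> = qform m a (\<lambda>i. v (i + p))"
    by (simp only: shift[of "\<lambda>j. a _ j * v (j + p) * _"]
        shift[of "\<lambda>i. \<Sum>j<m. a i j * v (j + p) * cnj (v (i + p))"] qform_def)
  finally show ?thesis .
qed

section \<open>Entries of positive forms\<close>

lemma psd_form_herm:
  assumes "psd_form m a" "i < m" "j < m"
  shows "a i j = cnj (a j i)"
  using assms by (intro qform_herm[of m]) (auto simp: less_eq_complex_def)

lemma psd_form_diag:
  assumes "psd_form m a" "i < m"
  shows "0 \<le> a i i"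
  using assms qform_one[of i m a] by metis

text \<open>Without a quadratic term in the \<open>i\<close>-th variable the form is real-affine in
  it, so a nonzero \<open>a i j\<close> would make it unbounded below.\<close>

lemma psd_form_zero_diag:
  assumes psd: "psd_form m a" and ij: "i < m" "j < m" and "a i i = 0"
  shows "a i j = 0"
proof (rule ccontr)
  assume nz: "a i j \<noteq> 0"
  then have "i \<noteq> j" using assms by auto
  \<comment> \<open>\<open>s\<close> is chosen so that the form takes the value
    \<open>a j j - (Re (a j j) + 1)\<close>, whose real part is \<open>-1\<close>.\<close>
  define s where "s = (Re (a j j) + 1) / (2 * (cmod (a i j))\<^sup>2)"
  let ?c = "- of_real s * a i j"
  have "0 \<le> qform m a ((\<lambda>_. 0)(j := 1, i := ?c))"
    using psd by blast
  also have "\<dots> = a j j + a j i * ?c + a i j * cnj ?c"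
    using qform_two[OF ij(2,1)] \<open>i \<noteq> j\<close> \<open>a i i = 0\<close> by simp
  also have "a j i = cnj (a i j)"
    by (rule psd_form_herm[OF psd ij(2,1)])
  also have "a j j + cnj (a i j) * ?c + a i j * cnj ?c =
      a j j - of_real (2 * s) * (a i j * cnj (a i j))"
    by (simp add: algebra_simps)
  also have "\<dots> = a j j - of_real (2 * s * (cmod (a i j))\<^sup>2)"
    by (simp add: complex_norm_square[symmetric])
  also have "2 * s * (cmod (a i j))\<^sup>2 = Re (a j j) + 1"
    using nz by (simp add: s_def field_simps)
  finally show False by (simp add: less_eq_complex_def)
qed

section \<open>Schur complements and rank one decompositions\<close>

definition schur :: "nat \<Rightarrow> (nat \<Rightarrow> nat \<Rightarrow> complex) \<Rightarrow> nat \<Rightarrow> nat \<Rightarrow> complex" where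
  "schur m a i j = a i j - a i m * a m j / a m m"

text \<open>Completing the square in the last variable. If \<open>a m m = 0\<close>, both divisions give \<open>0\<close>, which is
  the correct value because the whole row vanishes.\<close>

lemma schur_square:
  assumes psd: "psd_form (Suc m) a"
  defines "L \<equiv> \<lambda>v. \<Sum>j<m. a m j * v j"
  shows "qform (Suc m) a v =
    qform m (schur m a) v + a m m * of_real ((cmod (v m + L v / a m m))\<^sup>2)"
proof -
  have cL: "(\<Sum>i<m. a i m * cnj (v i)) = cnj (L v)"
    unfolding L_def cnj_sum complex_cnj_mult
  proof (rule sum.cong[OF refl])
    fix i assume "i \<in> {..<m}"
    then show "a i m * cnj (v i) = cnj (a m i) * cnj (v i)"
      using psd_form_herm[OF psd, of i m] by simp
  qed
  have real: "cnj (a m m) = a m m"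
    using psd_form_herm[OF psd, of m m] by simp
  have "qform m (\<lambda>i j. a i m * a m j / a m m) v = (\<Sum>i<m. a i m * cnj (v i)) * L v / a m m"
    unfolding qform_def L_def sum_product sum_divide_distrib
    by (intro sum.cong refl) (simp add: mult_ac)
  then have S: "qform m (schur m a) v = qform m a v - cnj (L v) * L v / a m m"
    unfolding schur_def[abs_def] qform_diff cL by simp
  have sq: "of_real ((cmod z)\<^sup>2) = z * cnj z" for z
    using complex_norm_square by simp
  have L: "(\<Sum>j<m. a m j * v j) = L v"
    by (simp add: L_def)
  show ?thesis
  proof (cases "a m m = 0")
    case True
    then have "L v = 0"
      using psd_form_zero_diag[OF psd, of m] by (simp add: L_def)
    then show ?thesis
      unfolding qform_Suc S cL L using True by simp
  next
    case False
    then show ?thesis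
      unfolding qform_Suc S cL sq L by (simp add: real field_simps)
  qed
qed

lemma schur_le:
  assumes "psd_form (Suc m) a"
  shows "qform m (schur m a) v \<le> qform (Suc m) a v"
proof -
  have *: "0 \<le> a m m * of_real r" if "r \<ge> 0" for r
    using psd_form_diag[OF assms, of m] that by (simp add: less_eq_complex_def)
  show ?thesis
    unfolding schur_square[OF assms] le_add_same_cancel1 by (rule *) simp
qed

lemma schur_attained:
  assumes "psd_form (Suc m) a"
  shows "\<exists>t. qform m (schur m a) v = qform (Suc m) a (v(m := t))"
proof
  \<comment> \<open>\<open>?t\<close> annihilates the square in \<open>schur_square\<close>; for
    \<open>a m m = 0\<close> that square has coefficient \<open>0\<close> anyway.\<close>
  let ?t = "- (\<Sum>j<m. a m j * v j) / a m m"
  have "(\<Sum>j<m. a m j * (v(m := ?t)) j) = (\<Sum>j<m. a m j * v j)"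
    by (intro sum.cong) auto
  then show "qform m (schur m a) v = qform (Suc m) a (v(m := ?t))"
    unfolding schur_square[OF assms] by (auto intro!: qform_cong)
qed

lemma psd_form_schur:
  assumes "psd_form (Suc m) a"
  shows "psd_form m (schur m a)"
  using schur_attained[OF assms] assms by metis

text \<open>Cholesky factorisation: each Schur complement splits off the rank one form spanned by
  the last column.\<close>

lemma psd_form_rank_one_sum:
  assumes "psd_form m a"
  shows "\<exists>x. \<forall>i<m. \<forall>j<m. a i j = (\<Sum>f<m. x f i * cnj (x f j))"
  using assms
proof (induction m arbitrary: a)
  case (Suc m)
  obtain x where x: "\<And>i j. i < m \<Longrightarrow> j < m \<Longrightarrow> schur m a i j = (\<Sum>f<m. x f i * cnj (x f j))"
    using Suc.IH[OF psd_form_schur[OF Suc.prems]] by blast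
  define r where "r = Re (a m m)"
  have r: "a m m = of_real r" "r \<ge> 0"
    using psd_form_diag[OF Suc.prems, of m] by (auto simp: r_def less_eq_complex_def complex_eq_iff)
  \<comment> \<open>The new vector is the last column over the square root of its pivot; a zero
    pivot gives the zero vector, and then its row and column vanish too. Old vectors are extended by
    \<open>0\<close> because \<open>schur m a\<close> is \<open>0\<close> in row and column
    \<open>m\<close>.\<close>
  define y where "y f i = (if f = m then a i m / of_real (sqrt r) else if i = m then 0 else x f i)"
    for f i
  have "a i j = (\<Sum>f<Suc m. y f i * cnj (y f j))" if ij: "i < Suc m" "j < Suc m" for i j
  proof -
    have jm: "cnj (a j m) = a m j"
      using psd_form_herm[OF Suc.prems, of m j] ij by simp
    have ss: "complex_of_real (sqrt r) * complex_of_real (sqrt r) = of_real r"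
      using r by (simp flip: of_real_mult)
    have last: "y m i * cnj (y m j) = a i m * a m j / a m m"
      by (simp add: y_def jm r(1) ss)
    have zero: "a m j = 0" "a i m = 0" if "a m m = 0"
      using psd_form_zero_diag[OF Suc.prems, of m] psd_form_herm[OF Suc.prems, of i m] ij that
      by simp_all
    have "(\<Sum>f<m. y f i * cnj (y f j)) = schur m a i j"
    proof (cases "i = m \<or> j = m")
      case True
      then have "(\<Sum>f<m. y f i * cnj (y f j)) = 0"
        by (intro sum.neutral) (auto simp: y_def)
      moreover have "schur m a i j = 0"
        using True zero by (cases "a m m = 0") (auto simp: schur_def)
      ultimately show ?thesis by simp
    next
      case False
      then have "schur m a i j = (\<Sum>f<m. x f i * cnj (x f j))"
        using ij by (intro x) auto
      also have "\<dots> = (\<Sum>f<m. y f i * cnj (y f j))"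
        using False by (intro sum.cong) (auto simp: y_def)
      finally show ?thesis ..
    qed
    then show ?thesis by (simp add: last schur_def)
  qed
  then show ?case by blast
qed simp

section \<open>Partial minima and limits of forms\<close>

text \<open>Minima over single variables compose, so iterated Schur complements minimise over the
  last \<open>N\<close> variables. Attainment is recorded because minimisers later serve as
  competitors in other minimisations.\<close>

lemma partial_minimum:
  assumes "psd_form (m + N) a"
  shows "\<exists>s. \<forall>v. (\<exists>w. (\<forall>i<m. w i = v i) \<and> qform m s v = qform (m + N) a w) \<and>
    (\<forall>w. (\<forall>i<m. w i = v i) \<longrightarrow> qform m s v \<le> qform (m + N) a w)"
  using assms
proof (induction N arbitrary: a)
  case 0
  have "qform m a w = qform m a v" if "\<forall>i<m. w i = v i" for v w
    using that by (auto intro: qform_cong)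
  then show ?case
    unfolding add_0_right by (intro exI[of _ a]) (metis order_refl)
next
  case (Suc N)
  then have psd: "psd_form (Suc (m + N)) a" by simp
  obtain s where s: "\<And>v. \<exists>w. (\<forall>i<m. w i = v i) \<and> qform m s v = qform (m + N) (schur (m + N) a) w"
    "\<And>v w. \<forall>i<m. w i = v i \<Longrightarrow> qform m s v \<le> qform (m + N) (schur (m + N) a) w"
    using Suc.IH[OF psd_form_schur[OF psd]] by blast
  have "\<exists>w. (\<forall>i<m. w i = v i) \<and> qform m s v = qform (m + Suc N) a w" for v
  proof -
    obtain w where w: "\<forall>i<m. w i = v i" "qform m s v = qform (m + N) (schur (m + N) a) w"
      using s(1) by blast
    \<comment> \<open>The minimiser differs from \<open>w\<close> only at index
      \<open>m + N\<close>, so it still extends \<open>v\<close>.\<close>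
    then show ?thesis
      using schur_attained[OF psd, of w] by (metis add_Suc_right fun_upd_apply not_add_less1)
  qed
  moreover have "qform m s v \<le> qform (m + Suc N) a w" if "\<forall>i<m. w i = v i" for v w
    using s(2)[OF that] schur_le[OF psd, of w] by simp
  ultimately show ?case by blast
qed

text \<open>Polarisation expresses every entry by finitely many values of the form.\<close>

lemma qform_convergent:
  assumes "\<And>v. convergent (\<lambda>N. qform m (s N) v)" "i < m" "j < m"
  shows "convergent (\<lambda>N. s N i j)"
proof -
  have d: "convergent (\<lambda>N. s N k k)" if "k < m" for k
    using assms(1)[of "(\<lambda>_. 0)(k := 1)"] by (simp add: qform_one[OF that])
  show ?thesis
  proof (cases "i = j")
    case True
    then show ?thesis using d assms by simp
  next
    case False
    let ?q = "\<lambda>c N. qform m (s N) ((\<lambda>_. 0)(i := 1, j := c)) - (s N i i + s N j j)"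
    \<comment> \<open>\<open>?q c N\<close> equals \<open>s N i j * c + s N j i * cnj c\<close>;
      this combination of \<open>c = 1\<close> and \<open>c = \<i>\<close> cancels
      \<open>s N j i\<close>.\<close>
    have eq: "s N i j = (?q 1 N - \<i> * ?q \<i> N) * (1 / 2)" for N
      by (simp add: qform_two[OF assms(2,3) False] algebra_simps)
    have q: "convergent (?q c)" for c
      by (intro convergent_diff convergent_add assms(1) d assms(2,3))
    show ?thesis
      unfolding eq
      by (rule convergent_mult[OF convergent_diff[OF q convergent_mult[OF convergent_const q]]
            convergent_const])
  qed
qed

lemma nonneg_complex_decseq_convergent:
  fixes f :: "nat \<Rightarrow> complex"
  assumes "\<And>N. 0 \<le> f N" "\<And>N. f (Suc N) \<le> f N"
  shows "convergent f"
proof -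
  have "convergent (\<lambda>N. Re (f N))"
    using assms by (intro Bseq_monoseq_convergent decseq_imp_monoseq decseq_SucI
        decseq_bounded[of _ 0]) (auto simp: less_eq_complex_def)
  then have "convergent (\<lambda>N. complex_of_real (Re (f N)))"
    unfolding convergent_def by (metis tendsto_of_real)
  moreover have "complex_of_real (Re (f N)) = f N" for N
    using assms(1)[of N] by (simp add: less_eq_complex_def complex_eq_iff)
  ultimately show ?thesis by simp
qed

lemma psd_form_limit:
  assumes "\<And>N. psd_form m (a N)"
    and "\<And>i j. i < m \<Longrightarrow> j < m \<Longrightarrow> (\<lambda>N. a N i j) \<longlonglongrightarrow> b i j"
  shows "psd_form m b"
proof
  fix v
  have "(\<lambda>N. qform m (a N) v) \<longlonglongrightarrow> qform m b v"
    unfolding qform_def using assms(2) by (intro tendsto_intros) auto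
  then have "(\<lambda>N. Re (qform m (a N) v)) \<longlonglongrightarrow> Re (qform m b v)"
    "(\<lambda>N. Im (qform m (a N) v)) \<longlonglongrightarrow> Im (qform m b v)"
    by (auto intro: tendsto_Re tendsto_Im)
  moreover have "0 \<le> Re (qform m (a N) v)" "Im (qform m (a N) v) = 0" for N
    using assms(1) by (auto simp: less_eq_complex_def)
  ultimately show "0 \<le> qform m b v"
    by (auto simp: less_eq_complex_def LIMSEQ_const_iff intro: LIMSEQ_le_const)
qed

section \<open>A positive Gram matrix from a banded block Toeplitz form\<close>

text \<open>The form R of the outline, with \<open>p\<close> the size of the first block.\<close>

definition border :: "nat \<Rightarrow> (nat \<Rightarrow> nat \<Rightarrow> complex) \<Rightarrow> nat \<Rightarrow> nat \<Rightarrow> complex" where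
  "border p t i j = (if i < p \<or> j < p then t i j else 0)"

text \<open>The matrix of R plus S on all but the first \<open>p\<close> variables minus S on all
  but the last \<open>p\<close>; \<open>m\<close> counts the scalar variables of S.\<close>

definition gram :: "nat \<Rightarrow> nat \<Rightarrow> (nat \<Rightarrow> nat \<Rightarrow> complex) \<Rightarrow> (nat \<Rightarrow> nat \<Rightarrow> complex) \<Rightarrow>
    nat \<Rightarrow> nat \<Rightarrow> complex" where
  "gram m p t s i j = border p t i j + (if p \<le> i \<and> p \<le> j then s (i - p) (j - p) else 0)
    - (if i < m \<and> j < m then s i j else 0)"

text \<open>Dynamic programming: continuing a vector optimally from its second block on bounds the
  minimum belonging to its first \<open>m\<close> variables. As the number of variables grows, both
  minima tend to the same form \<open>s\<close>.\<close>

theorem toeplitz_gram: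
  assumes psd: "\<And>N. psd_form N t"
    and toeplitz: "\<And>i j. t (i + p) (j + p) = t i j"
    and band: "\<And>i j. i < p \<Longrightarrow> m + p \<le> j \<Longrightarrow> t i j = 0 \<and> t j i = 0"
  shows "\<exists>s. psd_form (m + p) (gram m p t s)"
proof -
  have "\<forall>N. \<exists>s. \<forall>v. (\<exists>w. (\<forall>i<m. w i = v i) \<and> qform m s v = qform (m + N) t w) \<and>
    (\<forall>w. (\<forall>i<m. w i = v i) \<longrightarrow> qform m s v \<le> qform (m + N) t w)"
    using partial_minimum psd by blast
  then obtain S where
    attained: "\<And>N v. \<exists>w. (\<forall>i<m. w i = v i) \<and> qform m (S N) v = qform (m + N) t w"
    and le: "\<And>N v w. (\<forall>i<m. w i = v i) \<Longrightarrow> qform m (S N) v \<le> qform (m + N) t w"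
    by metis
  have "qform m (S (Suc N)) v \<le> qform m (S N) v" for N v
  proof -
    obtain w where w: "\<forall>i<m. w i = v i" "qform m (S N) v = qform (m + N) t w"
      using attained by blast
    \<comment> \<open>Padding by \<open>0\<close> turns a minimiser for \<open>N\<close> into a
      competitor for \<open>Suc N\<close> of equal value.\<close>
    have "qform m (S (Suc N)) v \<le> qform (m + Suc N) t (w(m + N := 0))"
      using w(1) by (intro le) auto
    also have "\<dots> = qform (m + N) t (w(m + N := 0))"
      by (rule qform_support) (auto simp: less_Suc_eq)
    also have "\<dots> = qform (m + N) t w"
      by (rule qform_cong) auto
    finally show ?thesis using w(2) by simp
  qed
  moreover have "0 \<le> qform m (S N) v" for N v
  proof -
    obtain w where "qform m (S N) v = qform (m + N) t w"
      using attained by blast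
    then show ?thesis using psd by simp
  qed
  ultimately have conv: "convergent (\<lambda>N. qform m (S N) v)" for v
    by (rule nonneg_complex_decseq_convergent[rotated])
  have "convergent (\<lambda>N. S N i j)" if "i < m" "j < m" for i j
    by (rule qform_convergent[where s = S, OF conv that])
  then obtain s where s: "\<And>i j. i < m \<Longrightarrow> j < m \<Longrightarrow> (\<lambda>N. S N i j) \<longlonglongrightarrow> s i j"
    unfolding convergent_def by metis
  \<comment> \<open>Removing a block leaves \<open>p\<close> variables fewer, hence
    \<open>S N\<close> against \<open>S (N + p)\<close>; both converge to \<open>s\<close>.\<close>
  define G where "G N i j = border p t i j
    + (if p \<le> i \<and> p \<le> j then S N (i - p) (j - p) else 0)
    - (if i < m \<and> j < m then S (N + p) i j else 0)" for N i j
  have "psd_form (m + p) (G N)" for N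
  proof
    fix v
    obtain w where w: "\<forall>i<m. w i = v (i + p)"
      "qform m (S N) (\<lambda>i. v (i + p)) = qform (m + N) t w"
      using attained[where N = N and v = "\<lambda>i. v (i + p)"] by blast
    \<comment> \<open>The first block of \<open>v\<close>, followed by an optimal continuation of
      the remaining ones.\<close>
    define u where "u i = (if i < p then v i else w (i - p))" for i
    have u: "u i = v i" if "i < m + p" for i
      using w(1) that by (simp add: u_def)
    have "qform m (S (N + p)) v \<le> qform (m + (N + p)) t u"
      using u by (intro le) auto
    \<comment> \<open>Entries outside the first block row and column are moved back by one block,
      which leaves the Toeplitz form of the shifted vector.\<close>
    also have "\<dots> = qform (m + N + p) (\<lambda>i j. border p t i j +
        (if p \<le> i \<and> p \<le> j then t (i - p) (j - p) else 0)) u"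
      unfolding add.assoc
    proof (rule qform_cong)
      fix i j
      show "t i j = border p t i j + (if p \<le> i \<and> p \<le> j then t (i - p) (j - p) else 0)"
        using toeplitz[of "i - p" "j - p"] by (auto simp: border_def)
    qed simp
    also have "\<dots> = qform (m + N + p) (border p t) u + qform (m + N) t (\<lambda>i. u (i + p))"
      unfolding qform_add qform_shift ..
    \<comment> \<open>By the band condition the first block interacts only with the first
      \<open>m + p\<close> variables, and there \<open>u\<close> agrees with
      \<open>v\<close>.\<close>
    also have "qform (m + N + p) (border p t) u = qform (m + p) (border p t) u"
      using band by (intro qform_support) (auto simp: border_def)
    also have "\<dots> = qform (m + p) (border p t) v"
      using u by (intro qform_cong) auto
    also have "qform (m + N) t (\<lambda>i. u (i + p)) = qform m (S N) (\<lambda>i. v (i + p))"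
      unfolding w(2) by (rule qform_cong) (auto simp: u_def)
    finally have "0 \<le> qform (m + p) (border p t) v + qform m (S N) (\<lambda>i. v (i + p))
        - qform m (S (N + p)) v"
      by simp
    also have "\<dots> = qform (m + p) (G N) v"
      unfolding G_def[abs_def] qform_diff qform_add qform_shift
      by (subst qform_restrict) simp_all
    finally show "0 \<le> qform (m + p) (G N) v" .
  qed
  moreover have "(\<lambda>N. G N i j) \<longlonglongrightarrow> gram m p t s i j" if "i < m + p" "j < m + p" for i j
  proof -
    have "(\<lambda>N. if p \<le> i \<and> p \<le> j then S N (i - p) (j - p) else 0) \<longlonglongrightarrow>
        (if p \<le> i \<and> p \<le> j then s (i - p) (j - p) else 0)"
      using s[of "i - p" "j - p"] that by auto
    moreover have "(\<lambda>N. if i < m \<and> j < m then S (N + p) i j else 0) \<longlonglongrightarrow>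
        (if i < m \<and> j < m then s i j else 0)"
      using LIMSEQ_ignore_initial_segment[OF s, of i j p] by auto
    ultimately show ?thesis
      unfolding G_def gram_def by (intro tendsto_intros)
  qed
  ultimately show ?thesis
    using psd_form_limit[of "m + p" G] by blast
qed

section \<open>Trigonometric polynomials\<close>

lemma cnj_on_circle: "z \<in> circle \<Longrightarrow> cnj z = inverse z"
  using complex_norm_square[of z] by (intro inverse_unique[symmetric]) simp

text \<open>A geometric sum: for \<open>0 < \<bar>k\<bar> < M\<close> the ratio is an
  \<open>M\<close>-th root of unity other than \<open>1\<close>. Such averages extract Fourier
  coefficients without integration.\<close>

lemma sum_roots_of_unity_powi:
  fixes k :: int
  assumes "\<bar>k\<bar> < int M"
  shows "(\<Sum>r<M. (cis (2 * pi / M) ^ r) powi k) = (if k = 0 then of_nat M else 0)"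
proof (cases "k = 0")
  case False
  define q where "q = cis (2 * pi / M) powi k"
  have M: "M > 0" using assms by simp
  have q: "q = cis (2 * pi * (of_int k / M))"
    unfolding q_def cis_power_int by (simp add: field_simps)
  have "q \<noteq> 1"
  proof
    assume "q = 1"
    then obtain a :: int where "2 * pi * (of_int k / M) = of_int a * (2 * pi)"
      unfolding q using cis_eq_1_iff by blast
    then have "real_of_int k = of_int (a * int M)"
      using M by (simp add: field_simps)
    then have "k = a * int M"
      by (simp only: of_int_eq_iff)
    then show False
      using assms False by (auto simp: abs_mult)
  qed
  moreover have "q ^ M = 1"
    unfolding q Complex.DeMoivre using M
    using cis_multiple_2pi[of "of_int k"] by (simp add: mult_ac)
  moreover have "(cis (2 * pi / M) ^ r) powi k = q ^ r" for r
    by (simp add: q_def power_int_power power_int_power' mult.commute)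
  ultimately show ?thesis
    using False by (simp add: geometric_sum)
qed simp

section \<open>Toeplitz forms of the coefficients\<close>

text \<open>Block matrices are flattened: scalar index \<open>k * p + i\<close> with
  \<open>i < p\<close> is position \<open>i\<close> in block \<open>k\<close>.\<close>

definition block_toeplitz :: "nat \<Rightarrow> (nat \<Rightarrow> nat \<Rightarrow> int \<Rightarrow> complex) \<Rightarrow> nat \<Rightarrow> nat \<Rightarrow> complex" where
  "block_toeplitz p c i j = c (i mod p) (j mod p) (int (i div p) - int (j div p))"

text \<open>Twisting the values at \<open>z\<close> by a power of \<open>z\<close> in each block
  keeps them positive; averaging over roots of unity then retains only the coefficient that matches
  the block distance.\<close>

lemma psd_form_block_toeplitz:
  assumes "p > 0"
    and psd: "\<And>z. z \<in> circle \<Longrightarrow>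
      psd_form p (\<lambda>i j. \<Sum>l\<in>{- int n + 1..int n - 1}. c i j l * z powi l)"
    and supp: "\<And>i j l. l \<notin> {- int n + 1..int n - 1} \<Longrightarrow> c i j l = 0"
  shows "psd_form N (block_toeplitz p c)"
proof (cases "N = 0")
  case True
  then show ?thesis by (simp add: qform_def)
next
  case N: False
  let ?I = "{- int n + 1..int n - 1}"
  \<comment> \<open>For indices below \<open>N\<close> the exponents in \<open>h\<close> are at most
    \<open>(n - 1) + (N - 1)\<close> in absolute value, so \<open>M\<close> nodes separate them from
    \<open>0\<close>.\<close>
  define M where "M = N + n"
  define h where "h z i j = (\<Sum>l\<in>?I. c (i mod p) (j mod p) l *
    z powi (l + int (j div p) - int (i div p)))" for z i j
  have pos: "0 \<le> qform N (h z) v" if z: "z \<in> circle" for z v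
  proof -
    let ?a = "\<lambda>i j. \<Sum>l\<in>?I. c i j l * z powi l"
    \<comment> \<open>\<open>X\<close> carries \<open>z ^ k\<close> times the identity in block
      column \<open>k\<close>; \<open>h z\<close> is the compression of \<open>?a\<close> by
      it.\<close>
    define X where "X k i = (if k = i mod p then z ^ (i div p) else 0)" for k i
    have cX: "cnj (X k i) = (if k = i mod p then cnj (z ^ (i div p)) else 0)" for k i
      by (simp add: X_def)
    have [simp]: "z \<noteq> 0" using z by auto
    have "(\<Sum>k<p. \<Sum>l<p. cnj (X k i) * X l j * ?a k l) = h z i j" for i j
    proof -
      have "(\<Sum>k<p. \<Sum>l<p. cnj (X k i) * X l j * ?a k l) =
          cnj (z ^ (i div p)) * z ^ (j div p) * ?a (i mod p) (j mod p)"
        unfolding cX using \<open>p > 0\<close>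
        by (simp add: X_def mult_delta_left mult_delta_right del: complex_cnj_power)
      also have "\<dots> = h z i j"
        unfolding h_def sum_distrib_left
        by (intro sum.cong refl)
          (simp add: cnj_on_circle[OF z] power_int_add power_int_diff field_simps)
      finally show ?thesis .
    qed
    then have "qform N (h z) v = qform p ?a (\<lambda>k. \<Sum>i<N. X k i * v i)"
      using qform_compress[where p = p and q = N and x = X and a = ?a and v = v] by simp
    then show ?thesis using psd[OF z] by simp
  qed
  have mean: "(\<Sum>r<M. h (cis (2 * pi / M) ^ r) i j) = of_nat M * block_toeplitz p c i j"
    if "i < N" "j < N" for i j
  proof -
    let ?d = "int (i div p) - int (j div p)"
    have d: "\<bar>l + int (j div p) - int (i div p)\<bar> < int M" if "l \<in> ?I" for l
    proof -
      have "i div p < N" "j div p < N"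
        using \<open>i < N\<close> \<open>j < N\<close> by (meson div_le_dividend le_less_trans)+
      then show ?thesis using that by (auto simp: M_def)
    qed
    have "(\<Sum>r<M. h (cis (2 * pi / M) ^ r) i j) = (\<Sum>l\<in>?I. c (i mod p) (j mod p) l *
        (\<Sum>r<M. (cis (2 * pi / M) ^ r) powi (l + int (j div p) - int (i div p))))"
      unfolding h_def by (subst sum.swap) (simp add: sum_distrib_left)
    also have "\<dots> = (\<Sum>l\<in>?I. if l = ?d then c (i mod p) (j mod p) ?d * of_nat M else 0)"
      by (intro sum.cong refl) (auto simp: sum_roots_of_unity_powi[OF d])
    \<comment> \<open>If \<open>?d\<close> lies outside \<open>?I\<close>, the sum is empty of
      matches and \<open>supp\<close> makes the entry \<open>0\<close> as well.\<close>
    also have "\<dots> = of_nat M * block_toeplitz p c i j"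
      unfolding block_toeplitz_def using supp[of ?d] by simp
    finally show ?thesis .
  qed
  show ?thesis
  proof
    fix v
    have "0 \<le> (\<Sum>r<M. qform N (h (cis (2 * pi / M) ^ r)) v)"
      by (intro sum_nonneg pos) (simp add: norm_power)
    also have "\<dots> = qform N (\<lambda>i j. of_nat M * block_toeplitz p c i j) v"
      unfolding qform_sum[symmetric] using mean by (intro qform_cong) auto
    also have "\<dots> = of_real (real M) * qform N (block_toeplitz p c) v"
      unfolding qform_scale by simp
    finally show "0 \<le> qform N (block_toeplitz p c) v"
      using N by (auto simp: less_eq_complex_def M_def zero_le_mult_iff)
  qed
qed

text \<open>The two copies of \<open>s\<close> in \<open>gram\<close> differ by a shift along the block diagonals, so they cancel.\<close>

lemma gram_block_diagonals:
  assumes ij: "i < p" "j < p"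
    and t: "t = block_toeplitz p c"
  shows "(\<Sum>k<Suc n. \<Sum>l<Suc n. gram (n * p) p t s (k * p + i) (l * p + j) * e (int k - int l)) =
    (\<Sum>l\<in>{- int n..int n}. c i j l * e l)"
proof -
  have lt: "k * p + i < n * p \<longleftrightarrow> k < n" if "i < p" for k i
  proof
    assume "k * p + i < n * p"
    then have "k * p < n * p" by linarith
    then show "k < n" by simp
  next
    assume "k < n"
    then have "Suc k * p \<le> n * p" by (intro mult_le_mono1) simp
    then show "k * p + i < n * p" using that by simp
  qed
  have le: "p \<le> k * p + i \<longleftrightarrow> 0 < k" if "i < p" for k i
    using that by (cases k) auto
  \<comment> \<open>Here \<open>n\<close> is the top degree, so there are \<open>Suc n\<close>
    blocks. Shifting both block indices by one preserves \<open>int k - int l\<close>, so both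
    copies of \<open>s\<close> yield the same sum of \<open>S\<close>.\<close>
  define S where "S k l = s (k * p + i) (l * p + j) * e (int k - int l)" for k l
  let ?B = "\<lambda>k l. border p t (k * p + i) (l * p + j) * e (int k - int l)"
  have "gram (n * p) p t s (k * p + i) (l * p + j) * e (int k - int l) =
    ?B k l + (if 0 < k \<and> 0 < l then S (k - 1) (l - 1) else 0)
     - (if k < n \<and> l < n then S k l else 0)" for k l
  proof -
    have "k * p + i - p = (k - 1) * p + i" "l * p + j - p = (l - 1) * p + j"
      "int (k - 1) - int (l - 1) = int k - int l" if "0 < k" "0 < l"
      using that by (auto simp: algebra_simps of_nat_diff diff_mult_distrib)
    then show ?thesis
      unfolding gram_def S_def lt[OF ij(1)] lt[OF ij(2)] le[OF ij(1)] le[OF ij(2)]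
      by (simp add: algebra_simps)
  qed
  then have "(\<Sum>k<Suc n. \<Sum>l<Suc n. gram (n * p) p t s (k * p + i) (l * p + j) * e (int k - int l)) =
    (\<Sum>k<Suc n. \<Sum>l<Suc n. ?B k l)
    + (\<Sum>k<Suc n. \<Sum>l<Suc n. if 0 < k \<and> 0 < l then S (k - 1) (l - 1) else 0)
    - (\<Sum>k<Suc n. \<Sum>l<Suc n. if k < n \<and> l < n then S k l else 0)"
    by (simp only: sum.distrib sum_subtractf)
  also have "(\<Sum>k<Suc n. \<Sum>l<Suc n. if 0 < k \<and> 0 < l then S (k - 1) (l - 1) else 0) =
      (\<Sum>k<n. \<Sum>l<n. S k l)"
    by (simp add: sum.lessThan_Suc_shift del: sum.lessThan_Suc)
  also have "(\<Sum>k<Suc n. \<Sum>l<Suc n. if k < n \<and> l < n then S k l else 0) = (\<Sum>k<n. \<Sum>l<n. S k l)"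
    by simp
  also have "(\<Sum>k<Suc n. \<Sum>l<Suc n. ?B k l) =
      (\<Sum>l<Suc n. c i j (- int l) * e (- int l)) + (\<Sum>k<n. c i j (int (Suc k)) * e (int (Suc k)))"
  proof -
    \<comment> \<open>In the first block row and column each difference occurs once:
      \<open>0\<close> down to \<open>- n\<close> in the row, \<open>1\<close> to \<open>n\<close>
      in the rest of the column.\<close>
    have B: "?B k l = (if k = 0 \<or> l = 0 then c i j (int k - int l) * e (int k - int l) else 0)" for k l
      using ij le[OF ij(1), of k] le[OF ij(2), of l]
      by (auto simp: border_def t block_toeplitz_def)
    show ?thesis
      unfolding B by (subst (1) sum.lessThan_Suc_shift) (simp add: sum.lessThan_Suc_shift del: sum.lessThan_Suc)
  qed
  also have "(\<Sum>l<Suc n. c i j (- int l) * e (- int l)) = (\<Sum>l\<in>{- int n..0}. c i j l * e l)"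
    by (rule sum.reindex_bij_witness[of _ "\<lambda>l. nat (- l)" "\<lambda>l. - int l"]) auto
  also have "(\<Sum>k<n. c i j (int (Suc k)) * e (int (Suc k))) = (\<Sum>l\<in>{1..int n}. c i j l * e l)"
    by (rule sum.reindex_bij_witness[of _ "\<lambda>l. nat l - 1" "\<lambda>l. int (Suc l)"]) auto
  also have "(\<Sum>l\<in>{- int n..0}. c i j l * e l) + (\<Sum>l\<in>{1..int n}. c i j l * e l) =
      (\<Sum>l\<in>{- int n..0} \<union> {1..int n}. c i j l * e l)"
    by (rule sum.union_disjoint[symmetric]) auto
  also have "{- int n..0} \<union> {1..int n} = {- int n..int n}"
    by auto
  finally show ?thesis by simp
qed

section \<open>Complete positivity\<close>

lemma (in operator_system) cone_sum_compress:
  fixes N :: nat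
  assumes "A \<in> os_cone S p" "\<And>f. X f \<in> carrier_mat p q"
  shows "mat q q (\<lambda>ij. \<Sum>f<N. os_compress S (X f) A $$ ij) \<in> os_cone S q"
proof (induction N)
  case 0
  \<comment> \<open>The zero matrix is positive as a compression by the zero matrix.\<close>
  have "mat q q (\<lambda>ij. \<Sum>f<0. os_compress S (X f) A $$ ij) = os_compress S (0\<^sub>m p q) A"
    by (intro eq_matI) (auto simp: os_compress_def)
  then show ?case
    using cone_compress[OF assms(1), of "0\<^sub>m p q" q] by simp
next
  case (Suc N)
  have "mat q q (\<lambda>ij. \<Sum>f<Suc N. os_compress S (X f) A $$ ij) =
      mat q q (\<lambda>ij. \<Sum>f<N. os_compress S (X f) A $$ ij) + os_compress S (X N) A"
    using assms(2)[of N] by (intro eq_matI) (auto simp: os_compress_def)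
  then show ?case
    using cone_add[OF Suc.IH cone_compress[OF assms(1,2)]] by simp
qed

lemma os_linear_sum:
  assumes "operator_system S" "operator_system T" "os_linear S T \<phi>"
    and "\<And>i. i \<in> I \<Longrightarrow> f i \<in> os_space S"
  shows "\<phi> (\<Sum>i\<in>I. os_scale S (c i) (f i)) = (\<Sum>i\<in>I. os_scale T (c i) (\<phi> (f i)))"
proof -
  interpret S: operator_system S by fact
  interpret T: operator_system T by fact
  have add: "\<phi> (x + y) = \<phi> x + \<phi> y" if "x \<in> os_space S" "y \<in> os_space S" for x y
    using assms(3) that unfolding os_linear_def by blast
  have scale: "\<phi> (os_scale S c x) = os_scale T c (\<phi> x)" if "x \<in> os_space S" for c x
    using assms(3) that unfolding os_linear_def by blast
  have zero: "\<phi> 0 = 0"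
    using scale[OF S.subspace_0[OF S.space], of 0] by simp
  show ?thesis
    using assms(4)
  proof (induction I rule: infinite_finite_induct)
    case (insert i I)
    have "os_scale S (c i) (f i) \<in> os_space S" "(\<Sum>i\<in>I. os_scale S (c i) (f i)) \<in> os_space S"
      using insert.prems by (auto intro!: S.subspace_scale[OF S.space] S.subspace_sum[OF S.space])
    then show ?case
      using insert by (simp add: add scale)
  qed (simp_all add: zero)
qed

section \<open>Characters and their Toeplitz matrix in the operator system\<close>

lemma circle_char_trig_poly:
  assumes "\<bar>j\<bar> < int n"
  shows "circle_char j \<in> trig_poly n"
proof (rule trig_polyI[where \<alpha> = "\<lambda>l. if l = j then 1 else 0"])
  fix z
  have "(\<Sum>l\<in>{- int n + 1..int n - 1}. (if l = j then 1 else 0) * circle_char l z) =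
      (\<Sum>l\<in>{- int n + 1..int n - 1}. if l = j then circle_char l z else 0)"
    by (intro sum.cong) auto
  then show "circle_char j z =
      (\<Sum>l\<in>{- int n + 1..int n - 1}. (if l = j then 1 else 0) * circle_char l z)"
    using assms by (simp add: abs_less_iff)
qed

lemma C_circle_n_fields:
  "os_space (C_circle_n n) = trig_poly n" "os_scale (C_circle_n n) = (\<lambda>c f z. c * f z)"
  "os_cone (C_circle_n n) p = {A \<in> os_cone C_circle p. \<forall>i<p. \<forall>j<p. A $$ (i, j) \<in> trig_poly n}"
  by (simp_all add: C_circle_n_def os_sub_def C_circle_def)

lemma toeplitz_mat_positive: "toeplitz_mat n \<in> os_cone (C_circle_n n) n"
proof -
  have pos: "0 \<le> qform n (\<lambda>i j. (toeplitz_mat n $$ (i, j)) z) v" if z: "z \<in> circle" for z v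
  proof -
    have "z \<noteq> 0" using z by auto
    let ?a = "\<Sum>i<n. z ^ i * cnj (v i)"
    have "qform n (\<lambda>i j. (toeplitz_mat n $$ (i, j)) z) v = qform n (\<lambda>i j. z ^ i * cnj (z ^ j)) v"
    proof (rule qform_cong)
      fix i j assume "i < n" "j < n"
      then have "(toeplitz_mat n $$ (i, j)) z = z powi (int i - int j)"
        using z by (simp add: toeplitz_mat_def circle_char_def)
      then show "(toeplitz_mat n $$ (i, j)) z = z ^ i * cnj (z ^ j)"
        using \<open>z \<noteq> 0\<close> by (simp add: cnj_on_circle[OF z] power_int_diff divide_inverse power_inverse)
    qed simp
    also have "\<dots> = ?a * cnj ?a"
      unfolding qform_def cnj_sum sum_product by (intro sum.cong refl) (simp add: mult_ac)
    also have "\<dots> = of_real ((cmod ?a)\<^sup>2)"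
      by (rule complex_norm_square[symmetric])
    finally show ?thesis by (simp add: less_eq_complex_def)
  qed
  have mats: "toeplitz_mat n \<in> os_mats C_circle n"
    by (simp add: os_mats_def toeplitz_mat_def C_circle_def circle_char_cont)
  have "toeplitz_mat n $$ (i, j) \<in> trig_poly n" if "i < n" "j < n" for i j
    using that by (auto simp: toeplitz_mat_def intro!: circle_char_trig_poly)
  then show ?thesis
    unfolding C_circle_n_fields mem_Collect_eq C_circle_cone_iff
    by (intro conjI allI impI ballI mats pos)
qed

text \<open>On the circle the right-hand side is the \<open>(i, j)\<close> entry of \<open>\<Sum>f. G f (G f)\<^sup>*\<close>, where the column
  \<open>G f\<close> has the entries \<open>\<Sum>k<n. x f (k * p + i) * z ^ k\<close>.\<close>

theorem fejer_riesz:
  assumes "n \<ge> 1" "p > 0" and A: "A \<in> os_cone (C_circle_n n) p"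
  shows "\<exists>x. \<forall>i<p. \<forall>j<p. \<forall>z. (A $$ (i, j)) z = (\<Sum>k<n. \<Sum>l<n.
    (\<Sum>f<n * p. x f (k * p + i) * cnj (x f (l * p + j))) * circle_char (int k - int l) z)"
proof -
  let ?I = "{- int n + 1..int n - 1}"
  obtain m where n: "n = Suc m" using assms(1) by (cases n) auto
  have "\<exists>\<alpha>. \<forall>z. (A $$ (i, j)) z = (\<Sum>l\<in>?I. \<alpha> l * circle_char l z)" if "i < p" "j < p" for i j
  proof -
    have "A $$ (i, j) \<in> trig_poly n"
      using A that by (simp add: C_circle_n_fields)
    then show ?thesis by (metis trig_polyE)
  qed
  then obtain \<alpha> where \<alpha>: "\<And>i j z. i < p \<Longrightarrow> j < p \<Longrightarrow>
      (A $$ (i, j)) z = (\<Sum>l\<in>?I. \<alpha> i j l * circle_char l z)"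
    by metis
  \<comment> \<open>Extension by \<open>0\<close> makes the coefficient meaningful for every block
    distance.\<close>
  define c where "c i j l = (if l \<in> ?I then \<alpha> i j l else 0)" for i j l
  have c: "(A $$ (i, j)) z = (\<Sum>l\<in>?I. c i j l * circle_char l z)" if "i < p" "j < p" for i j z
    unfolding \<alpha>[OF that] by (intro sum.cong) (auto simp: c_def)
  define t where "t = block_toeplitz p c"
  have psd: "psd_form N t" for N
    unfolding t_def
  proof (rule psd_form_block_toeplitz[OF \<open>p > 0\<close>])
    show "psd_form p (\<lambda>i j. \<Sum>l\<in>?I. c i j l * z powi l)" if z: "z \<in> circle" for z
    proof
      fix v
      have "0 \<le> qform p (\<lambda>i j. (A $$ (i, j)) z) v"
        using A z by (simp add: C_circle_n_fields C_circle_cone_iff)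
      also have "\<dots> = qform p (\<lambda>i j. \<Sum>l\<in>?I. c i j l * z powi l) v"
      proof (rule qform_cong)
        fix i j assume "i < p" "j < p"
        then show "(A $$ (i, j)) z = (\<Sum>l\<in>?I. c i j l * z powi l)"
          unfolding c[OF \<open>i < p\<close> \<open>j < p\<close>] using z by (simp only: circle_char_def if_True)
      qed simp
      finally show "0 \<le> qform p (\<lambda>i j. \<Sum>l\<in>?I. c i j l * z powi l) v" .
    qed
  qed (auto simp: c_def)
  have "\<exists>s. psd_form (m * p + p) (gram (m * p) p t s)"
  proof (rule toeplitz_gram[OF psd])
    show "t (i + p) (j + p) = t i j" for i j
      using \<open>p > 0\<close> by (simp add: t_def block_toeplitz_def)
    show "t i j = 0 \<and> t j i = 0" if "i < p" "m * p + p \<le> j" for i j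
    proof -
      \<comment> \<open>A block distance of at least \<open>n = Suc m\<close> exceeds the degree
        \<open>m\<close>, which gives the band condition.\<close>
      have "n \<le> j div p"
        using that(2) \<open>p > 0\<close> by (simp add: n less_eq_div_iff_mult_less_eq)
      then show ?thesis
        using that(1) by (simp add: t_def block_toeplitz_def c_def)
    qed
  qed
  moreover have "m * p + p = n * p"
    by (simp add: n)
  ultimately obtain s where s: "psd_form (n * p) (gram (m * p) p t s)"
    by metis
  then obtain x where x: "\<And>a b. a < n * p \<Longrightarrow> b < n * p \<Longrightarrow>
      gram (m * p) p t s a b = (\<Sum>f<n * p. x f a * cnj (x f b))"
    using psd_form_rank_one_sum[OF s] by blast
  have lt: "k * p + i < n * p" if "k < n" "i < p" for k i
  proof -
    have "Suc k * p \<le> n * p" using that by (intro mult_le_mono1) simp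
    then show ?thesis using that by simp
  qed
  have "(A $$ (i, j)) z = (\<Sum>k<n. \<Sum>l<n. (\<Sum>f<n * p. x f (k * p + i) * cnj (x f (l * p + j))) *
      circle_char (int k - int l) z)" if ij: "i < p" "j < p" for i j z
  proof -
    have "(A $$ (i, j)) z = (\<Sum>l\<in>{- int m..int m}. c i j l * circle_char l z)"
      unfolding c[OF ij] by (rule sum.cong) (auto simp: n)
    also have "\<dots> = (\<Sum>k<n. \<Sum>l<n. gram (m * p) p t s (k * p + i) (l * p + j) *
        circle_char (int k - int l) z)"
      unfolding n by (rule gram_block_diagonals[OF ij t_def, symmetric])
    also have "\<dots> = (\<Sum>k<n. \<Sum>l<n. (\<Sum>f<n * p. x f (k * p + i) * cnj (x f (l * p + j))) *
        circle_char (int k - int l) z)"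
      using ij by (intro sum.cong refl) (simp add: x lt)
    finally show ?thesis .
  qed
  then show ?thesis by blast
qed

theorem theorem1p11:
  fixes n :: nat and T :: "'t::ab_group_add os" and \<phi> :: "(complex \<Rightarrow> complex) \<Rightarrow> 't"
  assumes "n \<ge> 2"
    and "operator_system T"
    and "os_linear (C_circle_n n) T \<phi>"
  shows "completely_positive (C_circle_n n) T \<phi> \<longleftrightarrow>
    map_mat \<phi> (toeplitz_mat n) \<in> os_cone T n"
proof
  assume "completely_positive (C_circle_n n) T \<phi>"
  then show "map_mat \<phi> (toeplitz_mat n) \<in> os_cone T n"
    using toeplitz_mat_positive by (simp add: completely_positive_def)
next
  assume pos: "map_mat \<phi> (toeplitz_mat n) \<in> os_cone T n"
  interpret T: operator_system T by fact
  have S: "operator_system (C_circle_n n)"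
    using assms(1) by (intro operator_system_C_circle_n) simp
  show "completely_positive (C_circle_n n) T \<phi>"
    unfolding completely_positive_def
  proof (intro allI ballI)
    fix p A
    assume A: "A \<in> os_cone (C_circle_n n) p"
    then have cA: "A \<in> carrier_mat p p"
      by (simp add: C_circle_n_fields C_circle_cone_iff os_mats_def)
    \<comment> \<open>For \<open>p = 0\<close> any \<open>x\<close> will do; the factorisation
      covers \<open>p > 0\<close>.\<close>
    have "\<exists>x. \<forall>i<p. \<forall>j<p. \<forall>z. (A $$ (i, j)) z = (\<Sum>k<n. \<Sum>l<n.
      (\<Sum>f<n * p. x f (k * p + i) * cnj (x f (l * p + j))) * circle_char (int k - int l) z)"
      using fejer_riesz[OF _ _ A] assms(1) by (cases "p = 0") auto
    then obtain x where x: "\<And>i j z. i < p \<Longrightarrow> j < p \<Longrightarrow> (A $$ (i, j)) z = (\<Sum>k<n. \<Sum>l<n.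
      (\<Sum>f<n * p. x f (k * p + i) * cnj (x f (l * p + j))) * circle_char (int k - int l) z)"
      by blast
    \<comment> \<open>The conjugate compensates for \<open>os_compress\<close>, which conjugates the
      left factor.\<close>
    define X where "X f = mat n p (\<lambda>(k, i). cnj (x f (k * p + i)))" for f
    have "\<phi> (A $$ (i, j)) = (\<Sum>f<n * p. os_compress T (X f) (map_mat \<phi> (toeplitz_mat n)) $$ (i, j))"
      if ij: "i < p" "j < p" for i j
    proof -
      let ?c = "\<lambda>kl. \<Sum>f<n * p. x f (fst kl * p + i) * cnj (x f (snd kl * p + j))"
      let ?e = "\<lambda>kl. circle_char (int (fst kl) - int (snd kl))"
      let ?K = "{..<n} \<times> {..<n}"
      have "(A $$ (i, j)) z = (\<Sum>kl\<in>?K. ?c kl * ?e kl z)" for z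
        by (simp only: x[OF ij] sum.cartesian_product case_prod_unfold)
      then have eq: "A $$ (i, j) = (\<Sum>kl\<in>?K. os_scale (C_circle_n n) (?c kl) (?e kl))"
        by (intro ext) (simp only: sum_fun_apply C_circle_n_fields)
      \<comment> \<open>Linearity holds on \<open>trig_poly n\<close>, which contains the characters
        because \<open>k\<close> and \<open>l\<close> differ by less than \<open>n\<close>.\<close>
      have "\<phi> (A $$ (i, j)) = (\<Sum>kl\<in>?K. os_scale T (?c kl) (\<phi> (?e kl)))"
        unfolding eq
        by (rule os_linear_sum[OF S assms(2,3), where I = ?K and c = ?c and f = ?e])
          (auto simp only: C_circle_n_fields mem_Times_iff lessThan_iff intro!: circle_char_trig_poly)
      \<comment> \<open>With \<open>f\<close> outermost, each inner sum is an entry of one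
        compression of the image of the Toeplitz matrix.\<close>
      also have "\<dots> = (\<Sum>f<n * p. \<Sum>kl\<in>?K.
          os_scale T (x f (fst kl * p + i) * cnj (x f (snd kl * p + j))) (\<phi> (?e kl)))"
        unfolding T.scale_sum_left by (rule sum.swap)
      also have "\<dots> = (\<Sum>f<n * p. os_compress T (X f) (map_mat \<phi> (toeplitz_mat n)) $$ (i, j))"
        using ij by (intro sum.cong refl)
          (auto simp: os_compress_def X_def toeplitz_mat_def sum.cartesian_product case_prod_unfold
            intro!: sum.cong)
      finally show ?thesis .
    qed
    then have "map_mat \<phi> A =
        mat p p (\<lambda>ij. \<Sum>f<n * p. os_compress T (X f) (map_mat \<phi> (toeplitz_mat n)) $$ ij)"
      using cA by (intro eq_matI) auto
    then show "map_mat \<phi> A \<in> os_cone T p"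
      using T.cone_sum_compress[OF pos, of X p] by (simp add: X_def)
  qed
qed

end
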